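(* For every $d\ge0$, the $d$-th graded piece $(\operatorname{im}\Psi)_d=\Psi(\mathrm{Mat}_d)\subseteq\mathrm{WQSym}_d$ of the image of $\Psi$ is $$(\operatorname{im}\Psi)_d=\operatorname{span}_{\mathbb R}\{\Psi(N)\ :\ N\text{ is a loopless nested matroid on }[d]\}.$$ Moreover, $\dim\big((\operatorname{im}\Psi)_d\big)\le d!$.
   Context: $[d]=\{1,\dots,d\}$, $[0]=\emptyset$. For a matroid $M$ on $[d]$, $f\colon[d]\to\mathbb R$ and a basis $B$ put $f(B)=\sum_{i\in B}f(i)$; $f$ is $M$-generic if there is a unique basis $B$ of $M$ maximizing $f(B)$. Let $w_1,w_2,\dots$ be non-commuting variables and $w_f=w_{f(1)}\cdots w_{f(d)}$ for $f\colon[d]\to\mathbb Z_{\ge1}$. Then $\Psi(M)=\sum_{f} w_f$, the sum over all $M$-generic $f\colon[d]\to\mathbb Z_{\ge 1}$. The set composition type of $f$ is the ordered partition of $[d]$ into the level sets of $f$, listed by increasing value. $\mathrm{WQSym}_d$ is the real vector space of formal series $\sum_{f:[d]\to\mathbb Z_{\ge1}}c_fw_f$ with $c_f=c_g$ whenever $f,g$ have the same set composition type. $\mathrm{Mat}_d$ is the real vector space with basis all matroids on $[d]$, and $\Psi$ is extended linearly to it. A cyclic flat of a matroid is a flat that is the union of the circuits it contains. A matroid is nested if its cyclic flats form a chain under inclusion. A loop is an element contained in no basis; loopless means having no loops. *)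

theory Defs
  imports Complex_Main "HOL-Library.FuncSet" "HOL-Library.Poly_Mapping"
begin

text \<open>A matroid is represented by its ground set \<open>E\<close> together with its family \<open>\<B>\<close> of bases.\<close>

definition matroid :: "'a set \<Rightarrow> 'a set set \<Rightarrow> bool" where
  "matroid E \<B> \<longleftrightarrow>
     finite E \<and> \<B> \<noteq> {} \<and> (\<forall>B\<in>\<B>. B \<subseteq> E) \<and>
     (\<forall>A\<in>\<B>. \<forall>B\<in>\<B>. \<forall>x\<in>A - B. \<exists>y\<in>B - A. insert y (A - {x}) \<in> \<B>)"

definition indep :: "'a set set \<Rightarrow> 'a set \<Rightarrow> bool" where
  "indep \<B> I \<longleftrightarrow> (\<exists>B\<in>\<B>. I \<subseteq> B)"

definition circuit :: "'a set \<Rightarrow> 'a set set \<Rightarrow> 'a set \<Rightarrow> bool" where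
  "circuit E \<B> C \<longleftrightarrow> C \<subseteq> E \<and> \<not> indep \<B> C \<and> (\<forall>D. D \<subset> C \<longrightarrow> indep \<B> D)"

definition matroid_rank :: "'a set set \<Rightarrow> 'a set \<Rightarrow> nat" where
  "matroid_rank \<B> X = Max (card ` {I. I \<subseteq> X \<and> indep \<B> I})"

definition flat :: "'a set \<Rightarrow> 'a set set \<Rightarrow> 'a set \<Rightarrow> bool" where
  "flat E \<B> F \<longleftrightarrow>
     F \<subseteq> E \<and> (\<forall>x\<in>E - F. matroid_rank \<B> F < matroid_rank \<B> (insert x F))"

definition cyclic_flat :: "'a set \<Rightarrow> 'a set set \<Rightarrow> 'a set \<Rightarrow> bool" where
  "cyclic_flat E \<B> F \<longleftrightarrow> flat E \<B> F \<and> F = \<Union>{C. circuit E \<B> C \<and> C \<subseteq> F}"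

definition nested :: "'a set \<Rightarrow> 'a set set \<Rightarrow> bool" where
  "nested E \<B> \<longleftrightarrow> chain\<^sub>\<subseteq> {F. cyclic_flat E \<B> F}"

definition loop :: "'a set \<Rightarrow> 'a set set \<Rightarrow> 'a \<Rightarrow> bool" where
  "loop E \<B> x \<longleftrightarrow> x \<in> E \<and> (\<forall>B\<in>\<B>. x \<notin> B)"

definition loopless :: "'a set \<Rightarrow> 'a set set \<Rightarrow> bool" where
  "loopless E \<B> \<longleftrightarrow> (\<nexists>x. loop E \<B> x)"

definition generic :: "'a set set \<Rightarrow> ('a \<Rightarrow> real) \<Rightarrow> bool" where
  "generic \<B> f \<longleftrightarrow> (\<exists>!B. B \<in> \<B> \<and> (\<forall>B'\<in>\<B>. sum f B' \<le> sum f B))"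

text \<open>
  The monomial \<open>w\<^sub>a w\<^sub>b \<dots>\<close> in the non-commuting variables is the word
  \<open>[a, b, \<dots>]\<close>; a formal series is given by its coefficients.
\<close>

typedef ncseries = "UNIV :: (nat list \<Rightarrow> real) set"
  morphisms coeff Series ..

setup_lifting type_definition_ncseries

instantiation ncseries :: real_vector
begin

lift_definition zero_ncseries :: ncseries is "\<lambda>_. 0" .

lift_definition plus_ncseries :: "ncseries \<Rightarrow> ncseries \<Rightarrow> ncseries"
  is "\<lambda>p q u. p u + q u" .

lift_definition minus_ncseries :: "ncseries \<Rightarrow> ncseries \<Rightarrow> ncseries"
  is "\<lambda>p q u. p u - q u" .

lift_definition uminus_ncseries :: "ncseries \<Rightarrow> ncseries"
  is "\<lambda>p u. - p u" .

lift_definition scaleR_ncseries :: "real \<Rightarrow> ncseries \<Rightarrow> ncseries"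
  is "\<lambda>r p u. r * p u" .

instance
  by (standard; transfer; simp add: fun_eq_iff algebra_simps)

end

definition positive_maps :: "nat \<Rightarrow> (nat \<Rightarrow> nat) set" where
  "positive_maps d = {1..d} \<rightarrow>\<^sub>E {1..}"

definition word :: "nat \<Rightarrow> (nat \<Rightarrow> nat) \<Rightarrow> nat list" where
  "word d f = map f [1..<Suc d]"

text \<open>
  The formal series \<open>\<Sum>\<^sub>f c f \<cdot> w\<^sub>f\<close> over all \<open>f\<close> in \<^term>\<open>positive_maps d\<close>.
  Such an \<open>f\<close> is determined by its word, so each coefficient is a sum of at most one term.
\<close>

definition word_series :: "nat \<Rightarrow> ((nat \<Rightarrow> nat) \<Rightarrow> real) \<Rightarrow> ncseries" where
  "word_series d c = Series (\<lambda>u. \<Sum>f | f \<in> positive_maps d \<and> word d f = u. c f)"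

definition set_composition_type :: "nat \<Rightarrow> (nat \<Rightarrow> nat) \<Rightarrow> nat set list" where
  "set_composition_type d f =
     map (\<lambda>v. {i \<in> {1..d}. f i = v}) (sorted_list_of_set (f ` {1..d}))"

definition WQSym :: "nat \<Rightarrow> ncseries set" where
  "WQSym d = {word_series d c | c.
     \<forall>f\<in>positive_maps d. \<forall>g\<in>positive_maps d.
       set_composition_type d f = set_composition_type d g \<longrightarrow> c f = c g}"

definition Psi :: "nat \<Rightarrow> nat set set \<Rightarrow> ncseries" where
  "Psi d \<B> = word_series d (\<lambda>f. of_bool (generic \<B> (\<lambda>i. real (f i))))"

text \<open>
  The free real vector space on the matroids with ground set \<open>{1..d}\<close>: the finitely supported
  real-valued functions on families of bases whose support consists of such matroids.
\<close>

definition Mat :: "nat \<Rightarrow> (nat set set \<Rightarrow>\<^sub>0 real) set" where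
  "Mat d = {x. \<forall>\<B>\<in>Poly_Mapping.keys x. matroid {1..d} \<B>}"

definition Psi_lin :: "nat \<Rightarrow> (nat set set \<Rightarrow>\<^sub>0 real) \<Rightarrow> ncseries" where
  "Psi_lin d x = (\<Sum>\<B>\<in>Poly_Mapping.keys x. Poly_Mapping.lookup x \<B> *\<^sub>R Psi d \<B>)"

definition im_Psi :: "nat \<Rightarrow> ncseries set" where
  "im_Psi d = Psi_lin d ` Mat d"

end

theory Submission
  imports Defs
begin

text \<open>
  Loops may be exchanged for coloops without changing \<open>\<Psi>\<close>, so let \<open>M\<close> be loopless with rank function
  \<open>rk\<close>. For a chain \<open>C\<close> of subsets of \<open>E = [d]\<close> with \<open>E \<in> C\<close>, the sets \<open>B\<close> of size \<open>rk E\<close> with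
  \<open>|B \<inter> X| \<le> rk X\<close> for all \<open>X \<in> C\<close> are the bases of a loopless nested matroid \<open>S\<^sub>C\<close>. A set \<open>B\<close> is the
  unique \<open>f\<close>-maximal basis of \<open>S\<^sub>C\<close> iff \<open>C\<close> avoids a family of overfull sets and meets, for every
  \<open>y \<notin> B\<close>, a family of blocking sets; the same criterion with the chain replaced by all subsets of
  \<open>E\<close> describes \<open>M\<close>. Weights \<open>w\<^sub>C\<close> whose sum over the chains refining any given chain is \<open>1\<close> turn
  \<open>\<Sum>\<^sub>C w\<^sub>C [C avoids Q]\<close> into the signed count of chains in \<open>Q\<close>, which vanishes for conically
  contractible \<open>Q\<close>. By inclusion-exclusion, \<open>\<Psi>(M) = \<Sum>\<^sub>C w\<^sub>C \<Psi>(S\<^sub>C)\<close>.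

  For the dimension, drop redundant constraints from \<open>C\<close>. The number \<open>a\<^sub>n\<close> of irredundant systems on
  an \<open>n\<close>-set satisfies \<open>a\<^sub>n \<le> 1 + \<Sum>\<^sub>k (n choose k) (k - 1) a\<^sub>n\<^sub>-\<^sub>k\<close> (split off the innermost
  constraint, on \<open>k\<close> elements), and \<open>n!\<close> satisfies this recursion with equality.
\<close>

section \<open>Weight-maximal bases\<close>

text \<open>Names the witness in \<open>generic\<close>, so that the indicator of genericity can be
  split over the candidates \<open>B\<close>.\<close>

definition unique_max :: "'a set set \<Rightarrow> ('a \<Rightarrow> real) \<Rightarrow> 'a set \<Rightarrow> bool" where
  "unique_max \<B> f B \<longleftrightarrow> B \<in> \<B> \<and> (\<forall>A\<in>\<B>. A \<noteq> B \<longrightarrow> sum f A < sum f B)"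

context
  fixes E :: "'a set" and \<B> :: "'a set set"
  assumes M: "matroid E \<B>"
begin

lemma finite_ground: "finite E"
  and bases_nonempty: "\<B> \<noteq> {}"
  and basis_subset: "B \<in> \<B> \<Longrightarrow> B \<subseteq> E"
  and finite_basis: "B \<in> \<B> \<Longrightarrow> finite B"
  and finite_bases: "finite \<B>"
proof -
  show *: "finite E" "\<B> \<noteq> {}" and **: "\<And>B. B \<in> \<B> \<Longrightarrow> B \<subseteq> E"
    using M by (auto simp: matroid_def)
  show "B \<in> \<B> \<Longrightarrow> finite B"
    using * ** finite_subset by blast
  show "finite \<B>"
    using * ** by (meson PowI finite_Pow_iff finite_subset subsetI)
qed

lemma basis_exchange:
  assumes "A \<in> \<B>" "B \<in> \<B>" "x \<in> A" "x \<notin> B"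
  obtains y where "y \<in> B" "y \<notin> A" "insert y (A - {x}) \<in> \<B>"
proof -
  have "\<exists>y\<in>B - A. insert y (A - {x}) \<in> \<B>"
    using M assms unfolding matroid_def by blast
  then show thesis
    using that by blast
qed

lemma card_bases_eq:
  assumes "A \<in> \<B>" "B \<in> \<B>"
  shows "card A = card B"
  using assms
proof (induction "card (A - B)" arbitrary: A rule: less_induct)
  case less
  show ?case
  proof (cases "A \<subseteq> B")
    case True
    have "B \<subseteq> A"
    proof
      fix x assume "x \<in> B"
      show "x \<in> A"
      proof (rule ccontr)
        assume "x \<notin> A"
        then show False
          using basis_exchange[OF less.prems(2,1) \<open>x \<in> B\<close>] True by blast
      qed
    qed
    with True show ?thesis by simp
  next
    case False
    then obtain x where x: "x \<in> A" "x \<notin> B" by blast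
    then obtain y where y: "y \<in> B" "y \<notin> A" "insert y (A - {x}) \<in> \<B>"
      using basis_exchange[OF less.prems] by blast
    have fin: "finite A"
      using less.prems finite_basis by blast
    have "insert y (A - {x}) - B = (A - B) - {x}"
      using y by blast
    then have "card (insert y (A - {x}) - B) < card (A - B)"
      using x fin by (metis DiffI card_Diff1_less finite_Diff)
    then have "card (insert y (A - {x})) = card B"
      using less.hyps less.prems(2) y(3) by blast
    moreover have "card (insert y (A - {x})) = card A"
      using x y fin by (metis Diff_iff card_insert_disjoint card_Suc_Diff1 finite_Diff)
    ultimately show ?thesis by simp
  qed
qed

text \<open>Among the bases containing \<open>x\<close> and \<open>A \<inter> B\<close>, one that
  meets \<open>B\<close> most lies inside \<open>insert x B\<close>: any other element could be
  exchanged for one of \<open>B\<close>. Equal sizes then leave exactly one missing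
  \<open>y\<close>.\<close>

lemma dual_basis_exchange:
  assumes A: "A \<in> \<B>" and B: "B \<in> \<B>" and x: "x \<in> A" "x \<notin> B"
  obtains y where "y \<in> B" "y \<notin> A" "insert x (B - {y}) \<in> \<B>"
proof -
  define S where "S = {C \<in> \<B>. insert x (A \<inter> B) \<subseteq> C}"
  have "finite S" "A \<in> S"
    using finite_bases A x by (auto simp: S_def)
  then obtain C where C: "C \<in> S" and max: "\<And>D. D \<in> S \<Longrightarrow> card (D \<inter> B) \<le> card (C \<inter> B)"
    using Max_in[of "(\<lambda>D. card (D \<inter> B)) ` S"] Max_ge[of "(\<lambda>D. card (D \<inter> B)) ` S"]
    by fastforce
  have CB: "C \<in> \<B>" and sub: "insert x (A \<inter> B) \<subseteq> C"
    using C by (auto simp: S_def)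
  have fin: "finite C" "finite B"
    using CB B finite_basis by auto
  have "C \<subseteq> insert x B"
  proof
    fix z assume z: "z \<in> C"
    show "z \<in> insert x B"
    proof (rule ccontr)
      assume zn: "z \<notin> insert x B"
      then obtain y where y: "y \<in> B" "y \<notin> C" "insert y (C - {z}) \<in> \<B>"
        using basis_exchange[OF CB B z] by blast
      then have "insert y (C - {z}) \<in> S"
        using sub zn by (auto simp: S_def)
      moreover have "insert y (C - {z}) \<inter> B = insert y (C \<inter> B)"
        using y zn by blast
      ultimately show False
        using max[of "insert y (C - {z})"] y fin by simp
    qed
  qed
  then have sub2: "C - {x} \<subseteq> B" by blast
  moreover have "card (C - {x}) < card B"
    using card_bases_eq[OF CB B] fin sub by (metis card_Diff1_less insert_subset)
  ultimately obtain y where y: "y \<in> B" "y \<notin> C - {x}"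
    by (metis less_irrefl subsetI subset_antisym)
  have "y \<notin> A"
    using y sub x by blast
  have "card (B - {y}) = card (C - {x})"
    using y fin sub card_bases_eq[OF CB B] by simp
  then have "C - {x} = B - {y}"
    using sub2 y fin by (intro card_subset_eq) auto
  then have "insert x (B - {y}) = C"
    using sub by blast
  with CB y \<open>y \<notin> A\<close> that show thesis by blast
qed

text \<open>Taking for \<open>x\<close> a heaviest element of \<open>B - A\<close> bounds every
  \<open>v\<close> that leaves \<open>B\<close> in an exchange. So the exchange into
  \<open>A\<close> and the one into \<open>B\<close> need not be a single symmetric
  exchange.\<close>

lemma exchange_towards:
  fixes f :: "'a \<Rightarrow> real"
  assumes A: "A \<in> \<B>" and B: "B \<in> \<B>" and ne: "A \<noteq> B"
  obtains x y where "x \<in> B - A" "y \<in> A - B" "insert x (A - {y}) \<in> \<B>"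
    "\<And>u. u \<in> A - B \<Longrightarrow> \<exists>v\<in>B - A. insert u (B - {v}) \<in> \<B> \<and> f v \<le> f x"
proof -
  have "B - A \<noteq> {}"
    using ne A B card_bases_eq[OF A B] finite_basis[OF A]
    by (metis Diff_eq_empty_iff card_subset_eq)
  moreover have fin: "finite (B - A)"
    using finite_basis B by blast
  ultimately obtain x where x: "x \<in> B - A" "\<And>v. v \<in> B - A \<Longrightarrow> f v \<le> f x"
    using Max_in[of "f ` (B - A)"] Max_ge[of "f ` (B - A)"] by fastforce
  obtain y where "y \<in> A" "y \<notin> B" "insert x (A - {y}) \<in> \<B>"
    using dual_basis_exchange[OF B A] x(1) by blast
  moreover have "\<exists>v\<in>B - A. insert u (B - {v}) \<in> \<B> \<and> f v \<le> f x" if "u \<in> A - B" for u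
    using dual_basis_exchange[OF A B, of u] that x(2) by blast
  ultimately show thesis
    using that x(1) by blast
qed

lemma sum_exchange:
  fixes f :: "'a \<Rightarrow> real"
  assumes "A \<in> \<B>" "y \<in> A" "x \<notin> A"
  shows "sum f (insert x (A - {y})) = sum f A - f y + f x"
  using assms finite_basis[OF assms(1)] by (simp add: sum_diff1)

lemma card_exchange_less:
  assumes "A \<in> \<B>" "B \<in> \<B>" "x \<in> B - A" "y \<in> A - B"
  shows "card (insert x (A - {y}) - B) < card (A - B)"
proof -
  have "insert x (A - {y}) - B = (A - B) - {y}"
    using assms by blast
  then show ?thesis
    using assms finite_basis by (metis card_Diff1_less finite_Diff)
qed

text \<open>Walk from \<open>A\<close> to \<open>B\<close> by exchanges that replace
  \<open>y\<close> by \<open>x\<close>. No step loses weight, since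
  \<open>f y \<le> f v \<le> f x\<close> for an element \<open>v\<close> of \<open>B\<close> that
  \<open>y\<close> can replace.\<close>

lemma local_max_basis:
  fixes f :: "'a \<Rightarrow> real"
  assumes B: "B \<in> \<B>"
    and loc: "\<And>x y. \<lbrakk>x \<in> B; y \<in> E - B; insert y (B - {x}) \<in> \<B>\<rbrakk> \<Longrightarrow> f y \<le> f x"
    and "A \<in> \<B>"
  shows "sum f A \<le> sum f B"
  using \<open>A \<in> \<B>\<close>
proof (induction "card (A - B)" arbitrary: A rule: less_induct)
  case less
  show ?case
  proof (cases "A = B")
    case False
    obtain x y where xy: "x \<in> B - A" "y \<in> A - B" "insert x (A - {y}) \<in> \<B>"
      and "\<And>u. u \<in> A - B \<Longrightarrow> \<exists>v\<in>B - A. insert u (B - {v}) \<in> \<B> \<and> f v \<le> f x"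
      using exchange_towards[OF less.prems B False, where f = f] by metis
    then obtain v where "v \<in> B - A" "insert y (B - {v}) \<in> \<B>" "f v \<le> f x"
      by blast
    then have "f y \<le> f x"
      using loc[of v y] xy(2) basis_subset[OF less.prems] by force
    moreover have "sum f (insert x (A - {y})) \<le> sum f B"
      using less.hyps card_exchange_less[OF less.prems B] xy by blast
    ultimately show ?thesis
      using sum_exchange[OF less.prems, of y x f] xy by simp
  qed simp
qed

text \<open>For the converse, a strict gain in the first exchange suffices; from the exchanged basis
  onwards the weak bound \<open>local_max_basis\<close> takes over.\<close>

lemma unique_max_iff_local:
  "unique_max \<B> f B \<longleftrightarrow>
     B \<in> \<B> \<and> (\<forall>x\<in>B. \<forall>y\<in>E - B. insert y (B - {x}) \<in> \<B> \<longrightarrow> f y < f x)"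
    (is "?L \<longleftrightarrow> ?R")
proof
  assume L: ?L
  then have B: "B \<in> \<B>"
    by (simp add: unique_max_def)
  have "f y < f x" if "x \<in> B" "y \<in> E - B" "insert y (B - {x}) \<in> \<B>" for x y
  proof -
    have "insert y (B - {x}) \<noteq> B" using that by blast
    then have "sum f (insert y (B - {x})) < sum f B"
      using L that by (auto simp: unique_max_def)
    then show ?thesis
      using sum_exchange[OF B that(1), of y f] that(2) by simp
  qed
  with B show ?R by blast
next
  assume R: ?R
  then have B: "B \<in> \<B>" and loc: "\<And>x y. \<lbrakk>x \<in> B; y \<in> E - B; insert y (B - {x}) \<in> \<B>\<rbrakk> \<Longrightarrow> f y < f x"
    by auto
  have "sum f A < sum f B" if A: "A \<in> \<B>" and ne: "A \<noteq> B" for A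
  proof -
    obtain x y where xy: "x \<in> B - A" "y \<in> A - B" "insert x (A - {y}) \<in> \<B>"
      and "\<And>u. u \<in> A - B \<Longrightarrow> \<exists>v\<in>B - A. insert u (B - {v}) \<in> \<B> \<and> f v \<le> f x"
      using exchange_towards[OF A B ne, where f = f] by metis
    then obtain v where "v \<in> B - A" "insert y (B - {v}) \<in> \<B>" "f v \<le> f x"
      by blast
    then have "f y < f x"
      using loc[of v y] xy(2) basis_subset[OF A] by force
    moreover have "sum f (insert x (A - {y})) \<le> sum f B"
      using local_max_basis[OF B _ xy(3)] loc by (meson less_imp_le)
    ultimately show ?thesis
      using sum_exchange[OF A, of y x f] xy by simp
  qed
  with B show ?L
    by (auto simp: unique_max_def)
qed

lemma generic_iff_unique_max: "generic \<B> f \<longleftrightarrow> (\<exists>B. unique_max \<B> f B)"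
proof
  assume "generic \<B> f"
  then obtain B where B: "B \<in> \<B>" "\<And>A. A \<in> \<B> \<Longrightarrow> sum f A \<le> sum f B"
    and uniq: "\<And>A. A \<in> \<B> \<and> (\<forall>A'\<in>\<B>. sum f A' \<le> sum f A) \<Longrightarrow> A = B"
    unfolding generic_def by (elim ex1E) metis
  have "sum f A < sum f B" if "A \<in> \<B>" "A \<noteq> B" for A
  proof (rule ccontr)
    assume "\<not> sum f A < sum f B"
    then have "\<forall>A'\<in>\<B>. sum f A' \<le> sum f A"
      using B(2) by force
    with uniq that show False by blast
  qed
  with B show "\<exists>B. unique_max \<B> f B"
    by (auto simp: unique_max_def)
next
  assume "\<exists>B. unique_max \<B> f B"
  then obtain B where B: "B \<in> \<B>" "\<And>A. A \<in> \<B> \<Longrightarrow> A \<noteq> B \<Longrightarrow> sum f A < sum f B"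
    by (auto simp: unique_max_def)
  show "generic \<B> f"
    unfolding generic_def
  proof (rule ex1I[of _ B])
    show "B \<in> \<B> \<and> (\<forall>A\<in>\<B>. sum f A \<le> sum f B)"
      using B by (metis less_imp_le order_refl)
    show "A = B" if "A \<in> \<B> \<and> (\<forall>B'\<in>\<B>. sum f B' \<le> sum f A)" for A
      using B that by (meson not_le)
  qed
qed

text \<open>At most one \<open>B\<close> contributes, since two strict maxima cannot coexist. The
  expansion can therefore be proved for each \<open>B\<close> separately.\<close>

lemma of_bool_generic:
  assumes r: "\<And>B. B \<in> \<B> \<Longrightarrow> card B = r"
  shows "(of_bool (generic \<B> f) :: real) = (\<Sum>B | B \<subseteq> E \<and> card B = r. of_bool (unique_max \<B> f B))"
proof (cases "\<exists>B. unique_max \<B> f B")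
  case True
  then obtain B where B: "unique_max \<B> f B" by blast
  then have "unique_max \<B> f A \<longleftrightarrow> A = B" for A
    by (auto simp: unique_max_def dest: less_asym)
  moreover have "B \<subseteq> E" "card B = r"
    using B r basis_subset by (auto simp: unique_max_def)
  moreover have "finite {B. B \<subseteq> E \<and> card B = r}"
    using finite_ground by (auto intro: rev_finite_subset[of "Pow E"])
  ultimately show ?thesis
    using B by (auto simp: generic_iff_unique_max of_bool_def)
qed (simp add: generic_iff_unique_max)

section \<open>Rank as the largest intersection with a basis\<close>

lemma card_inter_le_rank:
  assumes A: "A \<in> \<B>"
  shows "card (A \<inter> X) \<le> matroid_rank \<B> X"
  unfolding matroid_rank_def
proof (rule Max_ge)
  have "{I. I \<subseteq> X \<and> indep \<B> I} \<subseteq> Pow E"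
    using basis_subset by (auto simp: indep_def)
  then show "finite (card ` {I. I \<subseteq> X \<and> indep \<B> I})"
    using finite_ground finite_subset by blast
  show "card (A \<inter> X) \<in> card ` {I. I \<subseteq> X \<and> indep \<B> I}"
    using A by (auto simp: indep_def)
qed

lemma rank_attained:
  obtains A where "A \<in> \<B>" "card (A \<inter> X) = matroid_rank \<B> X"
proof -
  let ?S = "{I. I \<subseteq> X \<and> indep \<B> I}"
  have "?S \<subseteq> Pow E"
    using basis_subset by (auto simp: indep_def)
  then have "finite ?S"
    using finite_ground finite_subset by blast
  moreover have "{} \<in> ?S"
    using bases_nonempty by (auto simp: indep_def)
  ultimately have "matroid_rank \<B> X \<in> card ` ?S"
    unfolding matroid_rank_def by (intro Max_in) auto
  then obtain I A where IA: "I \<subseteq> X" "I \<subseteq> A" "A \<in> \<B>" "card I = matroid_rank \<B> X"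
    by (auto simp: indep_def)
  then have "matroid_rank \<B> X \<le> card (A \<inter> X)"
    using finite_basis by (metis Int_subset_iff card_mono finite_Int)
  with card_inter_le_rank[OF \<open>A \<in> \<B>\<close>, of X] IA that show thesis
    by auto
qed

text \<open>Under the indicator weight of \<open>U\<close>, the hypothesis says that no exchange
  improves \<open>B\<close>, so \<open>local_max_basis\<close> makes
  \<open>card (B \<inter> U)\<close> maximal among the bases.\<close>

lemma rank_eq_card_inter:
  assumes B: "B \<in> \<B>"
    and loc: "\<And>x y. \<lbrakk>x \<in> B - U; y \<in> (E - B) \<inter> U; insert y (B - {x}) \<in> \<B>\<rbrakk> \<Longrightarrow> False"
  shows "card (B \<inter> U) = matroid_rank \<B> U"
proof -
  have sum: "sum (\<lambda>x. of_bool (x \<in> U) :: real) A = card (A \<inter> U)" if "A \<in> \<B>" for A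
    using finite_basis[OF that] by (simp add: of_bool_def sum.If_cases Int_def)
  obtain A where A: "A \<in> \<B>" "card (A \<inter> U) = matroid_rank \<B> U"
    by (rule rank_attained)
  have "sum (\<lambda>x. of_bool (x \<in> U) :: real) A \<le> sum (\<lambda>x. of_bool (x \<in> U)) B"
    by (rule local_max_basis[OF B _ A(1)]) (use loc in \<open>auto simp: of_bool_def\<close>)
  then have "card (A \<inter> U) \<le> card (B \<inter> U)"
    using sum A(1) B by simp
  with A card_inter_le_rank[OF B, of U] show ?thesis by simp
qed

lemma rank_ground: "B \<in> \<B> \<Longrightarrow> matroid_rank \<B> E = card B"
  using rank_eq_card_inter[of B E] basis_subset by (fastforce simp: Int_absorb2)

text \<open>A basis maximizing \<open>|A \<inter> (X \<inter> Y)| + |A \<inter> (X \<union> Y)|\<close> attains both ranks at once.\<close>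

lemma rank_submodular:
  "matroid_rank \<B> (X \<inter> Y) + matroid_rank \<B> (X \<union> Y) \<le> matroid_rank \<B> X + matroid_rank \<B> Y"
proof -
  define g :: "'a \<Rightarrow> real" where "g z = of_bool (z \<in> X \<inter> Y) + of_bool (z \<in> X \<union> Y)" for z
  obtain A where A: "A \<in> \<B>" "\<And>B. B \<in> \<B> \<Longrightarrow> sum g B \<le> sum g A"
    using Max_in[of "sum g ` \<B>"] Max_ge[of "sum g ` \<B>"] finite_bases bases_nonempty
    by fastforce
  \<comment> \<open>The two sets in \<open>g\<close> are nested, so an exchange that enlarges either
    intersection strictly raises \<open>g\<close>. Local maximality thus serves both sets.\<close>
  have loc: "g y \<le> g x" if "x \<in> A" "y \<in> E - A" "insert y (A - {x}) \<in> \<B>" for x y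
    using A(2)[OF that(3)] sum_exchange[OF A(1) that(1), of y g] that(2) by simp
  have "card (A \<inter> (X \<inter> Y)) = matroid_rank \<B> (X \<inter> Y)"
    by (rule rank_eq_card_inter[OF A(1)]) (use loc in \<open>fastforce simp: g_def of_bool_def split: if_splits\<close>)
  moreover have "card (A \<inter> (X \<union> Y)) = matroid_rank \<B> (X \<union> Y)"
    by (rule rank_eq_card_inter[OF A(1)]) (use loc in \<open>fastforce simp: g_def of_bool_def split: if_splits\<close>)
  moreover have "card (A \<inter> (X \<inter> Y)) + card (A \<inter> (X \<union> Y)) = card (A \<inter> X) + card (A \<inter> Y)"
    using card_Un_Int[of "A \<inter> X" "A \<inter> Y"] finite_basis[OF A(1)]
    by (simp add: Int_Un_distrib Int_ac)
  ultimately show ?thesis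
    using card_inter_le_rank[OF A(1), of X] card_inter_le_rank[OF A(1), of Y] by simp
qed

end

section \<open>Matroids defined by chains of rank constraints\<close>

text \<open>When the sets in \<open>K\<close> form a chain, these are the independent sets of a
  laminar matroid.\<close>

definition constraint_indep :: "'a set \<Rightarrow> ('a set \<times> nat) set \<Rightarrow> 'a set set" where
  "constraint_indep E K = {I. I \<subseteq> E \<and> (\<forall>(X, c)\<in>K. card (I \<inter> X) \<le> c)}"

definition constraint_bases :: "'a set \<Rightarrow> ('a set \<times> nat) set \<Rightarrow> 'a set set" where
  "constraint_bases E K =
     {B \<in> constraint_indep E K. \<forall>I\<in>constraint_indep E K. card I \<le> card B}"

lemma constraint_indepI:
  "\<lbrakk>I \<subseteq> E; \<And>X c. (X, c) \<in> K \<Longrightarrow> card (I \<inter> X) \<le> c\<rbrakk> \<Longrightarrow> I \<in> constraint_indep E K"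
  by (auto simp: constraint_indep_def)

lemma constraint_indepD:
  assumes "I \<in> constraint_indep E K"
  shows "I \<subseteq> E" and "(X, c) \<in> K \<Longrightarrow> card (I \<inter> X) \<le> c"
  using assms by (auto simp: constraint_indep_def)

context
  fixes E :: "'a set" and K :: "('a set \<times> nat) set"
  assumes fin: "finite E" and K: "K \<subseteq> Pow E \<times> UNIV"
    and chain: "chain\<^sub>\<subseteq> (fst ` K)"
begin

lemma finite_constraint_indep: "I \<in> constraint_indep E K \<Longrightarrow> finite I"
  by (rule finite_subset[OF constraint_indepD(1) fin])

lemma constraint_indep_mono:
  assumes I: "I \<in> constraint_indep E K" and "J \<subseteq> I"
  shows "J \<in> constraint_indep E K"
proof (rule constraint_indepI)
  show "J \<subseteq> E"
    using assms constraint_indepD(1) by blast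
  fix X c assume Xc: "(X, c) \<in> K"
  have "card (J \<inter> X) \<le> card (I \<inter> X)"
    using \<open>J \<subseteq> I\<close> finite_constraint_indep[OF I] by (intro card_mono) auto
  with constraint_indepD(2)[OF I Xc] show "card (J \<inter> X) \<le> c" by simp
qed

text \<open>A finite nonempty chain contains its union, so \<open>\<Union>T\<close> is the largest
  member of \<open>T\<close>.\<close>

lemma Union_constraints_mem:
  assumes "T \<subseteq> fst ` K" "T \<noteq> {}"
  shows "\<Union>T \<in> T"
proof -
  have "finite T"
    using assms(1) K fin by (intro finite_subset[of T "Pow E"]) fastforce+
  moreover have "subset.chain T T"
    using assms(1) chain unfolding subset_chain_def chain_subset_def by (meson order_refl subsetD)
  ultimately show ?thesis
    using assms(2) Union_in_chain by blast
qed

text \<open>The largest tight constraint set meets \<open>J\<close> in at most as many elements as \<open>I\<close>, so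
  \<open>J\<close> has a new element outside it; adding that element violates nothing.\<close>

lemma constraint_augment:
  assumes I: "I \<in> constraint_indep E K" and J: "J \<in> constraint_indep E K"
    and less: "card I < card J"
  obtains y where "y \<in> J - I" "insert y I \<in> constraint_indep E K"
proof -
  have finI: "finite I" "finite J"
    using I J finite_constraint_indep by auto
  define T where "T = {X. \<exists>c. (X, c) \<in> K \<and> card (I \<inter> X) = c}"
  have TK: "T \<subseteq> fst ` K"
    by (force simp: T_def)
  have "card (J \<inter> \<Union>T) \<le> card (I \<inter> \<Union>T)"
  proof (cases "T = {}")
    case False
    then have "\<Union>T \<in> T"
      using TK Union_constraints_mem by blast
    then have "(\<Union>T, card (I \<inter> \<Union>T)) \<in> K"
      unfolding T_def by auto
    then show ?thesis
      using constraint_indepD(2)[OF J] by blast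
  qed simp
  moreover have "card J = card (J \<inter> \<Union>T) + card (J - \<Union>T)" "card I = card (I \<inter> \<Union>T) + card (I - \<Union>T)"
    using finI by (metis Int_Diff_Un Int_Diff_disjoint card_Un_disjoint finite_Diff finite_Int)+
  ultimately have "card (I - \<Union>T) < card (J - \<Union>T)"
    using less by linarith
  then have "\<not> J - \<Union>T \<subseteq> I - \<Union>T"
    using finI card_mono[of "I - \<Union>T" "J - \<Union>T"] by auto
  then obtain y where y: "y \<in> J" "y \<notin> I" "y \<notin> \<Union>T"
    by blast
  have "insert y I \<in> constraint_indep E K"
  proof (rule constraint_indepI)
    show "insert y I \<subseteq> E"
      using I J y constraint_indepD(1) by blast
    fix X c assume Xc: "(X, c) \<in> K"
    have le: "card (I \<inter> X) \<le> c"
      using constraint_indepD(2)[OF I Xc] .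
    show "card (insert y I \<inter> X) \<le> c"
    proof (cases "y \<in> X")
      case True
      then have "card (I \<inter> X) \<noteq> c"
        using y(3) Xc by (auto simp: T_def)
      then show ?thesis
        using le True y(2) finI by (simp add: Int_insert_left)
    qed (use le in \<open>simp add: Int_insert_left\<close>)
  qed
  with y that show thesis by blast
qed

text \<open>By augmentation, a largest independent superset of \<open>I\<close> is also largest
  among all independent sets.\<close>

lemma constraint_indep_extend:
  assumes I: "I \<in> constraint_indep E K"
  obtains B where "B \<in> constraint_bases E K" "I \<subseteq> B"
proof -
  define S where "S = {J \<in> constraint_indep E K. I \<subseteq> J}"
  have "S \<subseteq> Pow E"
    using constraint_indepD(1) by (auto simp: S_def)
  then have "finite S"
    using fin finite_subset by blast
  moreover have "I \<in> S"
    using I by (simp add: S_def)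
  ultimately obtain B where B: "B \<in> S" "\<And>J. J \<in> S \<Longrightarrow> card J \<le> card B"
    using Max_in[of "card ` S"] Max_ge[of "card ` S"] by fastforce
  have "card J \<le> card B" if J: "J \<in> constraint_indep E K" for J
  proof (rule ccontr)
    assume "\<not> card J \<le> card B"
    then obtain y where y: "y \<in> J - B" "insert y B \<in> constraint_indep E K"
      using constraint_augment[of B J] B(1) J by (auto simp: S_def)
    then have "insert y B \<in> S"
      using B(1) by (auto simp: S_def)
    then have "card (insert y B) \<le> card B"
      by (rule B(2))
    then show False
      using y B(1) finite_constraint_indep by (auto simp: S_def)
  qed
  with B(1) that show thesis
    by (auto simp: S_def constraint_bases_def)
qed

lemma indep_constraint_bases:
  "indep (constraint_bases E K) I \<longleftrightarrow> I \<in> constraint_indep E K"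
proof
  show "I \<in> constraint_indep E K" if "indep (constraint_bases E K) I"
    using that constraint_indep_mono by (auto simp: indep_def constraint_bases_def)
  show "indep (constraint_bases E K) I" if "I \<in> constraint_indep E K"
    using constraint_indep_extend[OF that] by (auto simp: indep_def)
qed

text \<open>Basis exchange is augmentation of \<open>A - {x}\<close> from \<open>B\<close>; the new
  element is not \<open>x\<close>, which lies outside \<open>B\<close>.\<close>

lemma matroid_constraint_bases: "matroid E (constraint_bases E K)"
proof -
  have "{} \<in> constraint_indep E K"
    by (rule constraint_indepI) auto
  then have "constraint_bases E K \<noteq> {}"
    by (metis constraint_indep_extend empty_iff)
  moreover have "\<exists>y\<in>B - A. insert y (A - {x}) \<in> constraint_bases E K"
    if A: "A \<in> constraint_bases E K" and B: "B \<in> constraint_bases E K" and x: "x \<in> A - B" for A B x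
  proof -
    have AI: "A \<in> constraint_indep E K" and BI: "B \<in> constraint_indep E K"
      and max: "\<And>I. I \<in> constraint_indep E K \<Longrightarrow> card I \<le> card A"
      using A B by (auto simp: constraint_bases_def)
    have fins: "finite A" "finite B"
      using AI BI finite_constraint_indep by auto
    have "card A \<le> card B"
      using B AI by (auto simp: constraint_bases_def)
    then have "card (A - {x}) < card B"
      using x fins by (meson DiffD1 card_Diff1_less less_le_trans)
    then obtain y where y: "y \<in> B - (A - {x})" "insert y (A - {x}) \<in> constraint_indep E K"
      using constraint_augment[of "A - {x}" B] BI constraint_indep_mono[OF AI] by blast
    have yA: "y \<in> B - A"
      using y(1) x by blast
    then have "card (insert y (A - {x})) = card A"
      using x fins by (metis Diff_iff card_insert_disjoint card_Suc_Diff1 finite_Diff)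
    then have "insert y (A - {x}) \<in> constraint_bases E K"
      using y(2) max by (simp add: constraint_bases_def)
    with yA show ?thesis by blast
  qed
  moreover have "\<forall>B\<in>constraint_bases E K. B \<subseteq> E"
    using constraint_indepD(1) by (auto simp: constraint_bases_def)
  ultimately show ?thesis
    using fin unfolding matroid_def by blast
qed

lemma loopless_constraint_bases:
  assumes pos: "\<And>X c. (X, c) \<in> K \<Longrightarrow> X \<noteq> {} \<Longrightarrow> 1 \<le> c"
  shows "loopless E (constraint_bases E K)"
proof -
  have "\<not> loop E (constraint_bases E K) x" for x
  proof (cases "x \<in> E")
    case True
    have "{x} \<in> constraint_indep E K"
    proof (rule constraint_indepI)
      fix X c assume Xc: "(X, c) \<in> K"
      show "card ({x} \<inter> X) \<le> c"
        using pos[OF Xc] by (cases "x \<in> X") auto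
    qed (use True in simp)
    then obtain B where "B \<in> constraint_bases E K" "{x} \<subseteq> B"
      by (rule constraint_indep_extend)
    then show ?thesis
      by (auto simp: loop_def)
  qed (simp add: loop_def)
  then show ?thesis
    by (simp add: loopless_def)
qed

section \<open>Rank, circuits and cyclic flats of constraint matroids\<close>

lemma
  shows card_le_rank_constraint_bases:
      "\<lbrakk>I \<in> constraint_indep E K; I \<subseteq> F\<rbrakk> \<Longrightarrow> card I \<le> matroid_rank (constraint_bases E K) F"
    and rank_constraint_bases_le:
      "(\<And>I. \<lbrakk>I \<in> constraint_indep E K; I \<subseteq> F\<rbrakk> \<Longrightarrow> card I \<le> n) \<Longrightarrow>
         matroid_rank (constraint_bases E K) F \<le> n"
proof -
  have eq: "matroid_rank (constraint_bases E K) F = Max (card ` {I \<in> constraint_indep E K. I \<subseteq> F})"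
    unfolding matroid_rank_def indep_constraint_bases by (simp add: conj_commute)
  have "{I \<in> constraint_indep E K. I \<subseteq> F} \<subseteq> Pow E"
    using constraint_indepD(1) by blast
  then have finS: "finite {I \<in> constraint_indep E K. I \<subseteq> F}"
    using fin finite_subset by blast
  moreover have "{} \<in> {I \<in> constraint_indep E K. I \<subseteq> F}"
    by (auto intro: constraint_indepI)
  ultimately show "matroid_rank (constraint_bases E K) F \<le> n"
    if "\<And>I. \<lbrakk>I \<in> constraint_indep E K; I \<subseteq> F\<rbrakk> \<Longrightarrow> card I \<le> n"
    unfolding eq using that by (subst Max_le_iff) auto
  show "card I \<le> matroid_rank (constraint_bases E K) F"
    if "I \<in> constraint_indep E K" "I \<subseteq> F"
    unfolding eq using that finS by (intro Max_ge) auto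
qed

text \<open>The part of \<open>C\<close> inside a violated \<open>X\<close> violates the same bound,
  so by minimality it is all of \<open>C\<close>.\<close>

lemma circuit_constraint_bases:
  assumes C: "circuit E (constraint_bases E K) C"
  obtains X c where "(X, c) \<in> K" "C \<subseteq> X" "c < card C"
proof -
  have "C \<subseteq> E" "C \<notin> constraint_indep E K"
    and minimal: "\<And>D. D \<subset> C \<Longrightarrow> D \<in> constraint_indep E K"
    using C by (auto simp: circuit_def indep_constraint_bases)
  then obtain X c where Xc: "(X, c) \<in> K" "c < card (C \<inter> X)"
    using constraint_indepI[of C E K] by force
  have "C \<inter> X = C"
  proof (rule ccontr)
    assume "C \<inter> X \<noteq> C"
    then have "C \<inter> X \<in> constraint_indep E K"
      by (intro minimal) blast
    from constraint_indepD(2)[OF this Xc(1)] Xc(2) show False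
      by (simp add: Int_assoc)
  qed
  with Xc that[of X c] show thesis
    by (metis Int_lower2)
qed

text \<open>Every circuit in \<open>F\<close> overflows some constraint set, and the largest set so
  obtained, \<open>\<Union>T\<close>, covers \<open>F\<close>. A circuit overflowing it gives
  \<open>F\<close> rank at least \<open>c\<close>, so no further element of \<open>\<Union>T\<close>
  can raise the rank, and flatness puts it into \<open>F\<close>.\<close>

lemma cyclic_flat_constraint_bases:
  assumes F: "cyclic_flat E (constraint_bases E K) F" and "F \<noteq> {}"
  shows "F \<in> fst ` K"
proof -
  let ?circ = "circuit E (constraint_bases E K)"
  let ?rk = "matroid_rank (constraint_bases E K)"
  define T where "T = {X. \<exists>c C. (X, c) \<in> K \<and> ?circ C \<and> C \<subseteq> F \<and> C \<subseteq> X \<and> c < card C}"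
  have Feq: "F = \<Union>{C. ?circ C \<and> C \<subseteq> F}" and flat: "flat E (constraint_bases E K) F"
    using F by (simp_all add: cyclic_flat_def)
  have covered: "\<exists>X\<in>T. C \<subseteq> X" if "?circ C" "C \<subseteq> F" for C
  proof -
    obtain X c where "(X, c) \<in> K" "C \<subseteq> X" "c < card C"
      using circuit_constraint_bases[OF \<open>?circ C\<close>] .
    with that have "X \<in> T"
      unfolding T_def by blast
    with \<open>C \<subseteq> X\<close> show ?thesis by blast
  qed
  have "T \<noteq> {}"
    using Feq covered \<open>F \<noteq> {}\<close> by blast
  moreover have "T \<subseteq> fst ` K"
    by (force simp: T_def)
  ultimately have "\<Union>T \<in> T"
    using Union_constraints_mem by blast
  then obtain c C where Kc: "(\<Union>T, c) \<in> K" and C: "?circ C" "C \<subseteq> F" "c < card C"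
    unfolding T_def by blast
  have FT: "F \<subseteq> \<Union>T"
    using Feq covered by blast
  have "C \<noteq> {}"
    using C(3) by auto
  then obtain a where a: "a \<in> C" by blast
  have "C - {a} \<in> constraint_indep E K"
    using C(1) a by (auto simp: circuit_def indep_constraint_bases)
  then have "card (C - {a}) \<le> ?rk F"
    using C(2) by (intro card_le_rank_constraint_bases) auto
  moreover have "c \<le> card (C - {a})"
    using C(3) a by (simp add: card_Diff_singleton)
  ultimately have "c \<le> ?rk F" by simp
  have "\<Union>T \<subseteq> F"
  proof
    fix z assume z: "z \<in> \<Union>T"
    show "z \<in> F"
    proof (rule ccontr)
      assume "z \<notin> F"
      moreover have "z \<in> E"
        using z Kc K by blast
      ultimately have "?rk F < ?rk (insert z F)"
        using flat by (simp add: flat_def)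
      moreover have "?rk (insert z F) \<le> c"
      proof (rule rank_constraint_bases_le)
        fix I assume I: "I \<in> constraint_indep E K" "I \<subseteq> insert z F"
        then have "I \<inter> \<Union>T = I"
          using z FT by blast
        then show "card I \<le> c"
          using constraint_indepD(2)[OF I(1) Kc] by simp
      qed
      ultimately show False
        using \<open>c \<le> ?rk F\<close> by simp
    qed
  qed
  with FT Kc show ?thesis
    by (metis fst_conv image_eqI subset_antisym)
qed

lemma nested_constraint_bases: "nested E (constraint_bases E K)"
proof -
  have "{F. cyclic_flat E (constraint_bases E K) F} \<subseteq> insert {} (fst ` K)"
    using cyclic_flat_constraint_bases by blast
  moreover have "chain\<^sub>\<subseteq> (insert {} (fst ` K))"
    using chain by (auto simp: chain_subset_def)
  ultimately show ?thesis
    unfolding nested_def chain_subset_def by (meson subsetD)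
qed

end

section \<open>Irredundant chains of constraints\<close>

text \<open>\<open>c < card X\<close> excludes a vacuous bound, \<open>c < c'\<close> a bound on
  \<open>X\<close> implied by that on \<open>Y\<close>, and \<open>c' < c + card (Y - X)\<close> a
  bound on \<open>Y\<close> implied by that on \<open>X\<close>; \<open>1 \<le> c\<close> reflects
  looplessness. Comparing pairs by their bounds builds in the chain condition.\<close>

definition reduced :: "('a set \<times> nat) set \<Rightarrow> bool" where
  "reduced K \<longleftrightarrow>
     (\<forall>X c. (X, c) \<in> K \<longrightarrow> 1 \<le> c \<and> c < card X) \<and>
     (\<forall>X c Y c'. (X, c) \<in> K \<and> (Y, c') \<in> K \<and> (X, c) \<noteq> (Y, c') \<and> c \<le> c' \<longrightarrow>
        X \<subset> Y \<and> c < c' \<and> c' < c + card (Y - X))"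

lemma reducedI:
  assumes "\<And>X c. (X, c) \<in> K \<Longrightarrow> 1 \<le> c \<and> c < card X"
    and "\<And>X c Y c'. \<lbrakk>(X, c) \<in> K; (Y, c') \<in> K; (X, c) \<noteq> (Y, c'); c \<le> c'\<rbrakk> \<Longrightarrow>
      X \<subset> Y \<and> c < c' \<and> c' < c + card (Y - X)"
  shows "reduced K"
  using assms unfolding reduced_def by blast

lemma reducedD:
  assumes "reduced K" "(X, c) \<in> K"
  shows "1 \<le> c" "c < card X"
    and "\<lbrakk>(Y, c') \<in> K; (X, c) \<noteq> (Y, c'); c \<le> c'\<rbrakk> \<Longrightarrow> X \<subset> Y \<and> c < c' \<and> c' < c + card (Y - X)"
  using assms unfolding reduced_def by blast+

lemma ex_minimal_finite_subset:
  assumes "finite K" "P K"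
  obtains L where "L \<subseteq> K" "P L" "\<And>k. k \<in> L \<Longrightarrow> \<not> P (L - {k})"
proof -
  have "\<exists>L\<subseteq>K. P L \<and> (\<forall>k\<in>L. \<not> P (L - {k}))"
    using assms
  proof (induction K rule: finite_psubset_induct)
    case (psubset K)
    show ?case
    proof (cases "\<exists>k\<in>K. P (K - {k})")
      case True
      then obtain k where k: "k \<in> K" "P (K - {k})" by blast
      then have "\<exists>L\<subseteq>K - {k}. P L \<and> (\<forall>k\<in>L. \<not> P (L - {k}))"
        using psubset.IH[of "K - {k}"] by blast
      then show ?thesis by blast
    qed (use psubset.prems in blast)
  qed
  with that show thesis by blast
qed

lemma constraint_indep_Diff_implied:
  assumes "\<And>I. \<lbrakk>I \<subseteq> E; \<And>X c. (X, c) \<in> K - {(Y, b)} \<Longrightarrow> card (I \<inter> X) \<le> c\<rbrakk> \<Longrightarrow> card (I \<inter> Y) \<le> b"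
  shows "constraint_indep E (K - {(Y, b)}) = constraint_indep E K"
proof
  show "constraint_indep E (K - {(Y, b)}) \<subseteq> constraint_indep E K"
  proof
    fix I assume I: "I \<in> constraint_indep E (K - {(Y, b)})"
    show "I \<in> constraint_indep E K"
    proof (rule constraint_indepI)
      show "I \<subseteq> E"
        using I by (rule constraint_indepD)
      fix X c assume "(X, c) \<in> K"
      then show "card (I \<inter> X) \<le> c"
        using assms[of I] constraint_indepD[OF I] by (cases "(X, c) = (Y, b)") auto
    qed
  qed
qed (auto simp: constraint_indep_def)

text \<open>In a minimal subsystem with the same independent sets, each constraint has a set that
  violates it and no other. These witnesses yield the inequalities in
  \<open>reduced\<close>.\<close>

lemma ex_reduced:
  assumes fin: "finite E" "finite K" and K: "K \<subseteq> Pow E \<times> UNIV"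
    and chain: "chain\<^sub>\<subseteq> (fst ` K)"
    and pos: "\<And>X c. (X, c) \<in> K \<Longrightarrow> X \<noteq> {} \<Longrightarrow> 1 \<le> c"
  obtains L where "L \<subseteq> Pow E \<times> UNIV" "reduced L" "constraint_indep E L = constraint_indep E K"
proof -
  obtain L where LK: "L \<subseteq> K" and eq: "constraint_indep E L = constraint_indep E K"
    and minimal: "\<And>k. k \<in> L \<Longrightarrow> constraint_indep E (L - {k}) \<noteq> constraint_indep E K"
    using ex_minimal_finite_subset[OF fin(2), where P = "\<lambda>L. constraint_indep E L = constraint_indep E K"]
    by blast
  have needed: "\<exists>I\<subseteq>E. (\<forall>X c. (X, c) \<in> L - {(Y, b)} \<longrightarrow> card (I \<inter> X) \<le> c) \<and> b < card (I \<inter> Y)"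
    if "(Y, b) \<in> L" for Y b
  proof (rule ccontr)
    assume no: "\<not> ?thesis"
    have "card (I \<inter> Y) \<le> b"
      if "I \<subseteq> E" "\<And>X c. (X, c) \<in> L - {(Y, b)} \<Longrightarrow> card (I \<inter> X) \<le> c" for I
      using no that by (meson not_le)
    from constraint_indep_Diff_implied[OF this] minimal[OF that] eq show False by blast
  qed
  have small: "c < card X" if "(X, c) \<in> L" for X c
  proof -
    obtain I where "I \<subseteq> E" "c < card (I \<inter> X)"
      using needed[OF \<open>(X, c) \<in> L\<close>] by metis
    moreover have "finite X"
      using that LK K by (intro finite_subset[OF _ fin(1)]) auto
    then have "card (I \<inter> X) \<le> card X"
      by (intro card_mono) auto
    ultimately show ?thesis by simp
  qed
  have strict: "X \<subset> Y \<and> c < c' \<and> c' < c + card (Y - X)"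
    if XL: "(X, c) \<in> L" and YL: "(Y, c') \<in> L" and ne: "(X, c) \<noteq> (Y, c')"
      and sub: "X \<subset> Y \<or> X = Y \<and> c < c'" for X Y c c'
  proof -
    have finY: "finite Y"
      using YL LK K by (intro finite_subset[OF _ fin(1)]) auto
    have XY: "X \<subseteq> Y"
      using sub by blast
    \<comment> \<open>\<open>I\<close> violates only the bound on \<open>X\<close>, which forces
      \<open>c < c'\<close>; \<open>J\<close> below violates only the bound on \<open>Y\<close>,
      which gives the other inequality.\<close>
    obtain I where I: "I \<subseteq> E" "card (I \<inter> Y) \<le> c'" "c < card (I \<inter> X)"
      using needed[OF XL] YL ne by (metis DiffI singletonD)
    moreover have "card (I \<inter> X) \<le> card (I \<inter> Y)"
      using XY finY by (intro card_mono) auto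
    ultimately have "c < c'" by simp
    obtain J where J: "J \<subseteq> E" "card (J \<inter> X) \<le> c" "c' < card (J \<inter> Y)"
      using needed[OF YL] XL ne by (metis DiffI singletonD)
    have "J \<inter> Y \<subseteq> (J \<inter> X) \<union> (Y - X)" by blast
    then have "card (J \<inter> Y) \<le> card (J \<inter> X) + card (Y - X)"
      using finY by (meson XY card_Un_le card_mono dual_order.trans finite_Diff finite_Int finite_UnI finite_subset)
    with J have less: "c' < c + card (Y - X)" by simp
    with \<open>c < c'\<close> have "X \<noteq> Y" by auto
    with XY \<open>c < c'\<close> less show ?thesis by blast
  qed
  have "reduced L"
  proof (rule reducedI)
    show "1 \<le> c \<and> c < card X" if "(X, c) \<in> L" for X c
      using small[OF that] pos[of X c] that LK by (cases "X = {}") auto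
  next
    fix X c Y c' assume XY: "(X, c) \<in> L" "(Y, c') \<in> L" "(X, c) \<noteq> (Y, c')" "c \<le> c'"
    have "X \<in> fst ` K" "Y \<in> fst ` K"
      using XY(1,2) LK by force+
    then have "X \<subseteq> Y \<or> Y \<subseteq> X"
      using chain unfolding chain_subset_def by blast
    moreover have "c < c'" if "X = Y"
      using XY that by auto
    ultimately consider "X \<subset> Y \<or> X = Y \<and> c < c'" | "Y \<subset> X"
      by blast
    then show "X \<subset> Y \<and> c < c' \<and> c' < c + card (Y - X)"
    proof cases
      case 1
      then show ?thesis
        using strict XY by blast
    next
      case 2
      then show ?thesis
        using strict[of Y c' X c] XY by auto
    qed
  qed
  with LK K eq that show thesis by (meson subset_trans)
qed

text \<open>Inverse to splitting off the innermost constraint: \<open>K\<close> is the rest of the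
  system, transported to the complement of \<open>F\<close>.\<close>

definition prepend_constraint :: "'a set \<Rightarrow> nat \<Rightarrow> ('a set \<times> nat) set \<Rightarrow> ('a set \<times> nat) set" where
  "prepend_constraint F \<rho> K = insert (F, \<rho>) ((\<lambda>(X, c). (F \<union> X, \<rho> + c)) ` K)"

text \<open>The pair with the least bound is innermost. Deleting \<open>F\<close> from the other
  sets and subtracting \<open>\<rho>\<close> from their bounds keeps the system reduced:
  \<open>\<rho> < c\<close> becomes positivity, and \<open>c < \<rho> + card (X - F)\<close> becomes
  non-vacuity of the shifted bound.\<close>

lemma reduced_cases [consumes 3, case_names empty prepend]:
  assumes fin: "finite E" and K: "K \<subseteq> Pow E \<times> UNIV" and red: "reduced K"
  obtains "K = {}" | F \<rho> L where "F \<subseteq> E" "F \<noteq> {}" "1 \<le> \<rho>" "\<rho> < card F"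
    "L \<subseteq> Pow (E - F) \<times> UNIV" "reduced L" "K = prepend_constraint F \<rho> L"
proof (cases "K = {}")
  case False
  define \<rho> where "\<rho> = (LEAST c. \<exists>X. (X, c) \<in> K)"
  have "\<exists>c X. (X, c) \<in> K"
    using False by auto
  then have "\<exists>X. (X, \<rho>) \<in> K"
    unfolding \<rho>_def by (rule LeastI_ex)
  then obtain F where F: "(F, \<rho>) \<in> K" by blast
  have least: "\<rho> \<le> c" if "(X, c) \<in> K" for X c
    unfolding \<rho>_def using that by (intro Least_le) auto
  have above: "F \<subset> X" "\<rho> < c" "c < \<rho> + card (X - F)" if "(X, c) \<in> K" "(X, c) \<noteq> (F, \<rho>)" for X c
    using reducedD(3)[OF red F that(1)] that least by metis+
  define L where "L = (\<lambda>(X, c). (X - F, c - \<rho>)) ` (K - {(F, \<rho>)})"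
  have "prepend_constraint F \<rho> L = insert (F, \<rho>) ((\<lambda>(X, c). (F \<union> (X - F), \<rho> + (c - \<rho>))) ` (K - {(F, \<rho>)}))"
    unfolding prepend_constraint_def L_def image_image by (simp add: case_prod_unfold)
  also have "(\<lambda>(X, c). (F \<union> (X - F), \<rho> + (c - \<rho>))) ` (K - {(F, \<rho>)}) = (\<lambda>k. k) ` (K - {(F, \<rho>)})"
  proof (rule image_cong, simp)
    fix k assume k: "k \<in> K - {(F, \<rho>)}"
    obtain X c where "k = (X, c)" by force
    with k above[of X c] show "(case k of (X, c) \<Rightarrow> (F \<union> (X - F), \<rho> + (c - \<rho>))) = k" by auto
  qed
  finally have "K = prepend_constraint F \<rho> L"
    using F by auto
  moreover have "reduced L"
  proof (rule reducedI)
    fix X b assume "(X, b) \<in> L"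
    then obtain Y c where "X = Y - F" "b = c - \<rho>" "(Y, c) \<in> K" "(Y, c) \<noteq> (F, \<rho>)"
      by (auto simp: L_def)
    with above[of Y c] show "1 \<le> b \<and> b < card X" by auto
  next
    fix X b X' b'
    assume XL: "(X, b) \<in> L" and XL': "(X', b') \<in> L" and ne: "(X, b) \<noteq> (X', b')" and le: "b \<le> b'"
    obtain Y c where X: "X = Y - F" "b = c - \<rho>" and Y: "(Y, c) \<in> K" "(Y, c) \<noteq> (F, \<rho>)"
      using XL by (auto simp: L_def)
    obtain Y' c' where X': "X' = Y' - F" "b' = c' - \<rho>" and Y': "(Y', c') \<in> K" "(Y', c') \<noteq> (F, \<rho>)"
      using XL' by (auto simp: L_def)
    have "c \<le> c'" "(Y, c) \<noteq> (Y', c')"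
      using le ne above[OF Y] above[OF Y'] X X' by auto
    then have "Y \<subset> Y'" "c < c'" "c' < c + card (Y' - Y)"
      using reducedD(3)[OF red Y(1) Y'(1)] by auto
    moreover have "Y' - F - (Y - F) = Y' - Y"
      using above(1)[OF Y] by blast
    moreover have "X \<subset> X'"
      using \<open>Y \<subset> Y'\<close> above(1)[OF Y] X(1) X'(1) by blast
    ultimately show "X \<subset> X' \<and> b < b' \<and> b' < b + card (X' - X)"
      using above(2)[OF Y] X X' by auto
  qed
  moreover have "L \<subseteq> Pow (E - F) \<times> UNIV"
    using K by (auto simp: L_def)
  moreover have "1 \<le> \<rho>" "\<rho> < card F"
    using reducedD(1,2)[OF red F] by auto
  ultimately show thesis
    using that(2)[of F \<rho> L] F K by fastforce
qed (use that in blast)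

section \<open>Counting reduced systems\<close>

lemma sum_over_subset_cards:
  assumes "finite E"
  shows "(\<Sum>F\<in>Pow E. g (card F)) = (\<Sum>k\<le>card E. (card E choose k) * g k)"
proof -
  have "(\<Sum>F\<in>Pow E. g (card F)) = (\<Sum>k\<le>card E. \<Sum>F | F \<in> Pow E \<and> card F = k. g (card F))"
    using assms by (intro sum.group[symmetric]) (auto intro: card_mono)
  also have "\<dots> = (\<Sum>k\<le>card E. (card E choose k) * g k)"
    using n_subsets[OF assms] by (intro sum.cong) (auto simp: Pow_def)
  finally show ?thesis .
qed

text \<open>The summand is \<open>(k - 1) * fact n / fact k\<close> for positive \<open>k\<close>,
  and (k - 1)/k! = 1/(k - 1)! - 1/k! telescopes.\<close>

lemma sum_choose_fact_telescope:
  "1 + (\<Sum>k\<le>n. (n choose k) * ((k - 1) * fact (n - k))) = (fact n :: nat)"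
proof -
  have "(\<Sum>k\<le>m. (real k - 1) * (fact n / fact k)) = - (fact n / fact m)" if "m \<le> n" for m
    using that
  proof (induction m)
    case (Suc m)
    have "(fact n :: real) / fact m = real (Suc m) * (fact n / fact (Suc m))"
      by simp
    moreover have "(\<Sum>k\<le>m. (real k - 1) * (fact n / fact k)) = - (fact n / fact m)"
      using Suc by simp
    moreover have "- (real (Suc m) * x) + (real (Suc m) - 1) * x = - x" for x
      by algebra
    ultimately show ?case
      by (simp only: sum.atMost_Suc)
  qed simp
  then have *: "(\<Sum>k\<le>n. (real k - 1) * (fact n / fact k)) = - 1"
    by simp
  \<comment> \<open>In \<open>nat\<close> the term for \<open>k = 0\<close> vanishes because
    \<open>0 - 1 = 0\<close>; over the reals it is \<open>- fact n\<close>, hence the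
    correction.\<close>
  have "real ((n choose k) * ((k - 1) * fact (n - k))) =
      (real k - 1) * (fact n / fact k) + (if k = 0 then fact n else 0)" if "k \<le> n" for k
    using that by (cases k) (auto simp: binomial_fact)
  then have "real (\<Sum>k\<le>n. (n choose k) * ((k - 1) * fact (n - k))) = - 1 + fact n"
    using * by (simp add: sum.distrib del: of_nat_mult)
  then have "real (1 + (\<Sum>k\<le>n. (n choose k) * ((k - 1) * fact (n - k)))) = real (fact n)"
    by simp
  then show ?thesis
    by (simp only: of_nat_eq_iff)
qed

text \<open>A nonempty system comes from an innermost set \<open>F\<close>, one of
  \<open>card F - 1\<close> bounds and a system on \<open>E - F\<close>. The union bound and
  induction reduce the claim to \<open>sum_choose_fact_telescope\<close>.\<close>

lemma card_reduced_le:
  assumes "finite E"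
  shows "finite {K. K \<subseteq> Pow E \<times> UNIV \<and> reduced K}"
    and "card {K. K \<subseteq> Pow E \<times> UNIV \<and> reduced K} \<le> fact (card E)"
proof -
  let ?R = "\<lambda>E. {K. K \<subseteq> Pow E \<times> UNIV \<and> reduced K}"
  have "finite (?R E) \<and> card (?R E) \<le> fact (card E)"
    using assms
  proof (induction E rule: finite_psubset_induct)
    case (psubset E)
    define U where "U F = (\<Union>\<rho>\<in>{1..<card F}. prepend_constraint F \<rho> ` ?R (E - F))" for F
    have fin: "finite (?R (E - F))" and le: "card (?R (E - F)) \<le> fact (card E - card F)"
      if "F \<in> Pow E - {{}}" for F
      using psubset.IH[of "E - F"] psubset.hyps that finite_subset[of F E]
      by (auto simp: card_Diff_subset)
    have finU: "finite (U F)" if "F \<in> Pow E - {{}}" for F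
      using fin[OF that] by (auto simp: U_def)
    have sub: "?R E \<subseteq> insert {} (\<Union>F\<in>Pow E - {{}}. U F)"
    proof
      fix K assume "K \<in> ?R E"
      then have "K \<subseteq> Pow E \<times> UNIV" "reduced K" by auto
      from psubset.hyps this show "K \<in> insert {} (\<Union>F\<in>Pow E - {{}}. U F)"
      proof (cases rule: reduced_cases)
        case (prepend F \<rho> L)
        then have "K \<in> U F"
          by (auto simp: U_def)
        with prepend show ?thesis by blast
      qed simp
    qed
    have fins: "finite (insert {} (\<Union>F\<in>Pow E - {{}}. U F))"
      using finU psubset.hyps by blast
    have "finite (?R E)"
      using sub fins by (rule finite_subset)
    have "card (?R E) \<le> card (insert {} (\<Union>F\<in>Pow E - {{}}. U F))"
      using fins sub by (rule card_mono)
    also have "\<dots> \<le> 1 + card (\<Union>F\<in>Pow E - {{}}. U F)"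
      using card_insert_le_m1 by (simp add: card_insert_if fins[simplified])
    also have "card (\<Union>F\<in>Pow E - {{}}. U F) \<le> (\<Sum>F\<in>Pow E - {{}}. card (U F))"
      using psubset.hyps by (intro card_UN_le) auto
    also have "\<dots> \<le> (\<Sum>F\<in>Pow E - {{}}. (card F - 1) * fact (card E - card F))"
    proof (rule sum_mono)
      fix F assume F: "F \<in> Pow E - {{}}"
      have "card (U F) \<le> (\<Sum>\<rho>\<in>{1..<card F}. card (prepend_constraint F \<rho> ` ?R (E - F)))"
        unfolding U_def by (intro card_UN_le) auto
      also have "\<dots> \<le> (\<Sum>\<rho>\<in>{1..<card F}. fact (card E - card F))"
        by (intro sum_mono order_trans[OF card_image_le[OF fin[OF F]] le[OF F]])
      finally show "card (U F) \<le> (card F - 1) * fact (card E - card F)"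
        by simp
    qed
    \<comment> \<open>Admitting the empty \<open>F\<close> costs nothing: its factor
      \<open>0 - 1\<close> is 0 in \<open>nat\<close>.\<close>
    also have "\<dots> \<le> (\<Sum>F\<in>Pow E. (card F - 1) * fact (card E - card F))"
      using psubset.hyps by (intro sum_mono2) auto
    also have "\<dots> = (\<Sum>k\<le>card E. (card E choose k) * ((k - 1) * fact (card E - k)))"
      using sum_over_subset_cards[OF psubset.hyps, where g = "\<lambda>k. (k - 1) * fact (card E - k)"]
      by simp
    also have "1 + \<dots> = fact (card E)"
      by (rule sum_choose_fact_telescope)
    finally have "card (?R E) \<le> fact (card E)"
      by simp
    with \<open>finite (?R E)\<close> show ?case by blast
  qed
  then show "finite (?R E)" "card (?R E) \<le> fact (card E)"
    by auto
qed

section \<open>Signed counts of chains\<close>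

lemma sum_minus_one_power_card_Pow:
  assumes "finite A"
  shows "(\<Sum>D\<in>Pow A. (- 1) ^ card D) = (of_bool (A = {}) :: real)"
  using prod_diff_conv_sum[OF assms, where ?f1.0 = "\<lambda>_. 1 :: real" and ?f2.0 = "\<lambda>_. 1"] assms
  by (cases "A = {}") (simp_all add: power_0_left)

lemma prod_of_bool:
  "finite A \<Longrightarrow> (\<Prod>x\<in>A. of_bool (P x)) = (of_bool (\<forall>x\<in>A. P x) :: real)"
  by (induction A rule: finite_induct) auto

text \<open>Expands the product of \<open>1 - of_bool (C \<inter> T y = {})\<close> over
  \<open>A\<close>. Conditions of meeting a family become conditions of avoiding one, which
  \<open>sum_weights_avoiding\<close> can evaluate.\<close>

lemma of_bool_hits_inclusion_exclusion:
  assumes "finite A"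
  shows "(of_bool (C \<inter> Q = {} \<and> (\<forall>y\<in>A. C \<inter> T y \<noteq> {})) :: real) =
    (\<Sum>Y\<in>Pow A. (- 1) ^ card Y * of_bool (C \<inter> (Q \<union> \<Union> (T ` Y)) = {}))"
proof -
  have "(of_bool (\<forall>y\<in>A. C \<inter> T y \<noteq> {}) :: real) = (\<Prod>y\<in>A. of_bool (C \<inter> T y \<noteq> {}))"
    by (rule prod_of_bool[OF assms, symmetric])
  also have "\<dots> = (\<Prod>y\<in>A. 1 - of_bool (C \<inter> T y = {}))"
    by (intro prod.cong) auto
  also have "\<dots> = (\<Sum>Y\<in>Pow A. (- 1) ^ card Y * (\<Prod>y\<in>Y. of_bool (C \<inter> T y = {})))"
    using prod_diff_conv_sum[OF assms, where ?f1.0 = "\<lambda>_. 1 :: real" and ?f2.0 = "\<lambda>y. of_bool (C \<inter> T y = {})"]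
    by simp
  also have "\<dots> = (\<Sum>Y\<in>Pow A. (- 1) ^ card Y * of_bool (\<forall>y\<in>Y. C \<inter> T y = {}))"
    using assms by (intro sum.cong refl) (simp add: prod_of_bool finite_subset)
  finally have "(of_bool (C \<inter> Q = {} \<and> (\<forall>y\<in>A. C \<inter> T y \<noteq> {})) :: real) =
      of_bool (C \<inter> Q = {}) * (\<Sum>Y\<in>Pow A. (- 1) ^ card Y * of_bool (\<forall>y\<in>Y. C \<inter> T y = {}))"
    by (simp add: of_bool_conj)
  also have "\<dots> = (\<Sum>Y\<in>Pow A. (- 1) ^ card Y * of_bool (C \<inter> (Q \<union> \<Union> (T ` Y)) = {}))"
    unfolding sum_distrib_left by (intro sum.cong refl) auto
  finally show ?thesis .
qed

text \<open>The sum runs over a conically contractible poset, \<open>G \<ge> G \<inter> F\<^sub>0 \<le> F\<^sub>0\<close>. On a chain \<open>D\<close>, toggling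
  \<open>G \<inter> F\<^sub>0\<close> for the least \<open>G \<in> D\<close> with \<open>\<not> G \<subseteq> F\<^sub>0\<close> (or \<open>F\<^sub>0\<close> itself if there is none) is a
  sign-reversing involution.\<close>

lemma signed_chain_count_eq_0:
  assumes "finite Q" and F\<^sub>0: "F\<^sub>0 \<in> Q" and meet: "\<And>G. G \<in> Q \<Longrightarrow> G \<inter> F\<^sub>0 \<in> Q"
  shows "(\<Sum>D | D \<subseteq> Q \<and> chain\<^sub>\<subseteq> D. (- 1) ^ card D) = (0 :: real)"
proof -
  let ?S = "{D. D \<subseteq> Q \<and> chain\<^sub>\<subseteq> D}"
  define N where "N D = {G \<in> D. \<not> G \<subseteq> F\<^sub>0}" for D
  define t where "t D = F\<^sub>0 \<inter> \<Inter> (N D)" for D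
  define \<phi> where "\<phi> D = (if t D \<in> D then D - {t D} else insert (t D) D)" for D
  have tQ: "t D \<in> Q" if D: "D \<in> ?S" for D
  proof (cases "N D = {}")
    case True
    then show ?thesis
      using F\<^sub>0 by (simp add: t_def)
  next
    case False
    have "subset.chain (N D) (N D)"
      using D by (auto simp: N_def subset_chain_def chain_subset_def)
    moreover have "finite (N D)"
      using D \<open>finite Q\<close> by (auto simp: N_def intro: finite_subset)
    ultimately have "\<Inter> (N D) \<in> N D"
      using False Inter_in_chain by blast
    then have "\<Inter> (N D) \<inter> F\<^sub>0 \<in> Q"
      using D meet by (auto simp: N_def)
    then show ?thesis
      by (simp add: t_def Int_commute)
  qed
  \<comment> \<open>\<open>t D\<close> lies inside \<open>F\<^sub>0\<close>, so toggling it leaves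
    \<open>N D\<close>, and hence \<open>t D\<close>, unchanged. This makes \<open>\<phi>\<close> an
    involution.\<close>
  have N\<phi>: "N (\<phi> D) = N D" for D
    by (auto simp: \<phi>_def N_def t_def)
  have comparable: "H \<subseteq> t D \<or> t D \<subseteq> H" if D: "D \<in> ?S" and H: "H \<in> D" for D H
  proof (cases "H \<subseteq> F\<^sub>0")
    case True
    \<comment> \<open>The alternative \<open>G \<subseteq> H\<close> would put \<open>G\<close>
      inside \<open>F\<^sub>0\<close>, against the definition of \<open>N D\<close>.\<close>
    have "H \<subseteq> G" if "G \<in> N D" for G
    proof -
      have "H \<subseteq> G \<or> G \<subseteq> H"
        using D H that by (auto simp: N_def chain_subset_def)
      then show ?thesis
        using that True by (auto simp: N_def)
    qed
    with True show ?thesis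
      by (auto simp: t_def)
  next
    case False
    with H show ?thesis
      by (auto simp: t_def N_def)
  qed
  have \<phi>S: "\<phi> D \<in> ?S" if D: "D \<in> ?S" for D
  proof -
    have "chain\<^sub>\<subseteq> (insert (t D) D)"
      using D comparable[OF D] unfolding chain_subset_def by blast
    then have "chain\<^sub>\<subseteq> (\<phi> D)"
      unfolding \<phi>_def chain_subset_def by auto
    with D tQ[OF D] show ?thesis
      by (auto simp: \<phi>_def)
  qed
  have t\<phi>: "t (\<phi> D) = t D" for D
    by (simp add: t_def N\<phi>)
  have \<phi>\<phi>: "\<phi> (\<phi> D) = D" for D
    unfolding \<phi>_def[of "\<phi> D"] t\<phi> by (auto simp: \<phi>_def)
  have sign: "- ((- 1) ^ card (\<phi> D)) = ((- 1) ^ card D :: real)" if D: "D \<in> ?S" for D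
  proof -
    have "finite D"
      using D \<open>finite Q\<close> by (auto intro: finite_subset)
    then have "card D = Suc (card (\<phi> D)) \<or> card (\<phi> D) = Suc (card D)"
      using card_Suc_Diff1[of D "t D"] by (cases "t D \<in> D") (simp_all add: \<phi>_def)
    then show ?thesis by auto
  qed
  have "(\<Sum>D\<in>?S. (- 1) ^ card D) = (\<Sum>D\<in>?S. - ((- 1) ^ card D :: real))"
    by (rule sum.reindex_bij_witness[of _ \<phi> \<phi>]) (use \<phi>S \<phi>\<phi> sign in auto)
  then show ?thesis
    by (simp add: sum_negf)
qed

text \<open>The equations are triangular: a minimal \<open>D\<close> contains no other member, so
  its weight enters only its own equation and can be chosen last.\<close>

lemma ex_superset_weights:
  assumes "finite \<C>"
  shows "\<exists>w :: 'a set \<Rightarrow> real. \<forall>D\<in>\<C>. (\<Sum>C | C \<in> \<C> \<and> D \<subseteq> C. w C) = 1"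
  using assms
proof (induction \<C> rule: finite_psubset_induct)
  case (psubset \<C>)
  show ?case
  proof (cases "\<C> = {}")
    case False
    then obtain D where D: "D \<in> \<C>" and minimal: "\<And>C. C \<in> \<C> \<Longrightarrow> C \<subseteq> D \<Longrightarrow> C = D"
      using finite_has_minimal[OF psubset.hyps] by blast
    then obtain w :: "'a set \<Rightarrow> real"
      where w: "\<And>A. A \<in> \<C> - {D} \<Longrightarrow> (\<Sum>C | C \<in> \<C> - {D} \<and> A \<subseteq> C. w C) = 1"
      using psubset.IH[of "\<C> - {D}"] by blast
    define v where "v = w(D := 1 - (\<Sum>C | C \<in> \<C> - {D} \<and> D \<subseteq> C. w C))"
    have "(\<Sum>C | C \<in> \<C> \<and> A \<subseteq> C. v C) = 1" if A: "A \<in> \<C>" for A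
    proof (cases "A = D")
      case True
      have "{C. C \<in> \<C> \<and> D \<subseteq> C} = insert D {C. C \<in> \<C> - {D} \<and> D \<subseteq> C}"
        using D by blast
      moreover have "(\<Sum>C | C \<in> \<C> - {D} \<and> D \<subseteq> C. v C) = (\<Sum>C | C \<in> \<C> - {D} \<and> D \<subseteq> C. w C)"
        by (intro sum.cong) (auto simp: v_def)
      ultimately show ?thesis
        using True psubset.hyps by (simp add: v_def)
    next
      case False
      have "(\<Sum>C | C \<in> \<C> \<and> A \<subseteq> C. v C) = (\<Sum>C | C \<in> \<C> - {D} \<and> A \<subseteq> C. w C)"
        using minimal[OF A] False by (intro sum.cong) (auto simp: v_def)
      with w A False show ?thesis by simp
    qed
    then show ?thesis by blast
  qed simp
qed

text \<open>Membership of \<open>E\<close> bounds the independent sets of a chain matroid by the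
  rank of the original matroid.\<close>

definition ground_chains :: "'a set \<Rightarrow> 'a set set set" where
  "ground_chains E = {C. C \<subseteq> Pow E \<and> chain\<^sub>\<subseteq> C \<and> E \<in> C}"

lemma finite_ground_chains: "finite E \<Longrightarrow> finite (ground_chains E)"
  unfolding ground_chains_def by (rule finite_subset[of _ "Pow (Pow E)"]) auto

text \<open>Write the indicator of avoiding \<open>Q\<close> as the alternating sum over the subsets
  \<open>D\<close> of \<open>C \<inter> Q\<close>, all of them chains. After swapping the sums, each
  \<open>D\<close> collects total weight 1.\<close>

lemma sum_weights_avoiding:
  fixes w :: "'a set set \<Rightarrow> real"
  assumes fin: "finite E" and Q: "Q \<subseteq> Pow E"
    and w: "\<And>D. D \<in> ground_chains E \<Longrightarrow> (\<Sum>C | C \<in> ground_chains E \<and> D \<subseteq> C. w C) = 1"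
  shows "(\<Sum>C\<in>ground_chains E. w C * of_bool (C \<inter> Q = {})) = (\<Sum>D | D \<subseteq> Q \<and> chain\<^sub>\<subseteq> D. (- 1) ^ card D)"
proof -
  let ?S = "{D. D \<subseteq> Q \<and> chain\<^sub>\<subseteq> D}"
  have "finite (Pow Q)"
    using fin Q by (simp add: finite_subset)
  then have finS: "finite ?S"
    by (rule finite_subset[rotated]) auto
  have avoid: "of_bool (C \<inter> Q = {}) = (\<Sum>D\<in>?S. (- 1) ^ card D * of_bool (D \<subseteq> C) :: real)"
    if C: "C \<in> ground_chains E" for C
  proof -
    have sub: "chain\<^sub>\<subseteq> D" if "D \<subseteq> C" for D
      using C that unfolding ground_chains_def chain_subset_def by blast
    have "finite (C \<inter> Q)"
      using fin Q by (meson finite_Int finite_Pow_iff finite_subset)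
    then have "of_bool (C \<inter> Q = {}) = (\<Sum>D\<in>Pow (C \<inter> Q). (- 1) ^ card D :: real)"
      by (rule sum_minus_one_power_card_Pow[symmetric])
    also have "Pow (C \<inter> Q) = ?S \<inter> {D. D \<subseteq> C}"
      using sub by auto
    also have "(\<Sum>D\<in>?S \<inter> {D. D \<subseteq> C}. (- 1) ^ card D :: real) = (\<Sum>D\<in>?S. (- 1) ^ card D * of_bool (D \<subseteq> C))"
      using finS by (simp add: of_bool_def if_distrib sum.If_cases cong: if_cong)
    finally show ?thesis .
  qed
  have total: "(\<Sum>C\<in>ground_chains E. w C * of_bool (D \<subseteq> C)) = 1" if D: "D \<in> ?S" for D
  proof -
    \<comment> \<open>\<open>D\<close> may lack \<open>E\<close>, but a ground chain contains
      \<open>D\<close> exactly if it contains \<open>insert E D\<close>.\<close>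
    have "insert E D \<in> ground_chains E"
      using D Q by (auto simp: ground_chains_def chain_subset_def)
    then have "(\<Sum>C | C \<in> ground_chains E \<and> insert E D \<subseteq> C. w C) = 1"
      by (rule w)
    moreover have "{C. C \<in> ground_chains E \<and> insert E D \<subseteq> C} = ground_chains E \<inter> {C. D \<subseteq> C}"
      by (auto simp: ground_chains_def)
    ultimately show ?thesis
      using finite_ground_chains[OF fin] by (simp add: of_bool_def if_distrib sum.If_cases cong: if_cong)
  qed
  have "(\<Sum>C\<in>ground_chains E. w C * of_bool (C \<inter> Q = {})) =
      (\<Sum>C\<in>ground_chains E. \<Sum>D\<in>?S. (- 1) ^ card D * (w C * of_bool (D \<subseteq> C)))"
    by (intro sum.cong refl) (simp only: avoid sum_distrib_left mult_ac)
  also have "\<dots> = (\<Sum>D\<in>?S. \<Sum>C\<in>ground_chains E. (- 1) ^ card D * (w C * of_bool (D \<subseteq> C)))"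
    by (rule sum.swap)
  also have "\<dots> = (\<Sum>D\<in>?S. (- 1) ^ card D)"
    using total by (simp flip: sum_distrib_left)
  finally show ?thesis .
qed

section \<open>Expansion into chain matroids\<close>

text \<open>Only the rank conditions on members of \<open>C\<close> are kept; if \<open>C\<close> is
  a ground chain, every basis of \<open>\<B>\<close> remains a basis.\<close>

definition chain_matroid :: "'a set \<Rightarrow> 'a set set \<Rightarrow> 'a set set \<Rightarrow> 'a set set" where
  "chain_matroid E \<B> C = constraint_bases E ((\<lambda>X. (X, matroid_rank \<B> X)) ` C)"

definition overfull :: "'a set \<Rightarrow> 'a set set \<Rightarrow> 'a set \<Rightarrow> 'a set set" where
  "overfull E \<B> B = {X. X \<subseteq> E \<and> matroid_rank \<B> X < card (B \<inter> X)}"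

text \<open>A blocking set certifies that exchanging an element of \<open>B\<close> for \<open>y\<close> always lowers the weight:
  as \<open>X\<close> is tight, \<open>y\<close> cannot replace anything outside \<open>X\<close>.\<close>

definition blocking :: "'a set \<Rightarrow> 'a set set \<Rightarrow> ('a \<Rightarrow> real) \<Rightarrow> 'a set \<Rightarrow> 'a \<Rightarrow> 'a set set" where
  "blocking E \<B> f B y =
     {X. X \<subseteq> E \<and> card (B \<inter> X) = matroid_rank \<B> X \<and> y \<in> X \<and> (\<forall>x\<in>B \<inter> X. f y < f x)}"

context
  fixes E :: "'a set" and \<B> :: "'a set set"
  assumes M: "matroid E \<B>"
begin

text \<open>For the backward direction the set \<open>B\<close> itself is the only test needed: its
  rank is then \<open>card B\<close>, so some basis contains it, and the sizes agree.\<close>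

lemma basis_iff_no_overfull:
  assumes B: "B \<subseteq> E" "card B = matroid_rank \<B> E"
  shows "B \<in> \<B> \<longleftrightarrow> overfull E \<B> B = {}"
proof
  assume "B \<in> \<B>"
  then show "overfull E \<B> B = {}"
    using card_inter_le_rank[OF M] by (auto simp: overfull_def not_less)
next
  assume "overfull E \<B> B = {}"
  then have "card B \<le> matroid_rank \<B> B"
    using B(1) by (auto simp: overfull_def not_less)
  obtain A where A: "A \<in> \<B>" "card (A \<inter> B) = matroid_rank \<B> B"
    by (rule rank_attained[OF M])
  have fins: "finite A" "finite B"
    using finite_basis[OF M A(1)] B(1) finite_ground[OF M] finite_subset by auto
  then have "A \<inter> B = B"
    using A(2) \<open>card B \<le> _\<close> by (intro card_seteq) auto
  moreover have "card A = card B"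
    using rank_ground[OF M A(1)] B(2) by simp
  ultimately have "A = B"
    using fins by (metis Int_lower1 card_subset_eq)
  with A(1) show "B \<in> \<B>" by simp
qed

lemma unique_max_iff_blocking:
  assumes B: "B \<subseteq> E" "card B = matroid_rank \<B> E"
  shows "unique_max \<B> f B \<longleftrightarrow>
    overfull E \<B> B = {} \<and> (\<forall>y\<in>E - B. blocking E \<B> f B y \<noteq> {})" (is "_ \<longleftrightarrow> ?R")
proof
  assume um: "unique_max \<B> f B"
  then have BB: "B \<in> \<B>" and loc: "\<And>x y. \<lbrakk>x \<in> B; y \<in> E - B; insert y (B - {x}) \<in> \<B>\<rbrakk> \<Longrightarrow> f y < f x"
    by (auto simp: unique_max_iff_local[OF M])
  \<comment> \<open>The blocking set consists of \<open>y\<close> and everything strictly heavier.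
    An exchange enlarging its intersection with \<open>B\<close> would bring in an element at least
    as heavy as \<open>y\<close> for one at most as heavy, against local maximality.\<close>
  have "insert y {z \<in> E. f y < f z} \<in> blocking E \<B> f B y" (is "?U \<in> _") if y: "y \<in> E - B" for y
  proof -
    have "card (B \<inter> ?U) = matroid_rank \<B> ?U"
    proof (rule rank_eq_card_inter[OF M BB])
      fix x z assume "x \<in> B - ?U" "z \<in> (E - B) \<inter> ?U" "insert z (B - {x}) \<in> \<B>"
      moreover from this have "f z < f x"
        using loc by blast
      moreover have "x \<in> E"
        using B(1) \<open>x \<in> B - ?U\<close> by blast
      ultimately show False by auto
    qed
    with y show ?thesis
      by (auto simp: blocking_def)
  qed
  with BB basis_iff_no_overfull[OF B] show ?R by blast
next
  assume R: ?R
  then have BB: "B \<in> \<B>"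
    using basis_iff_no_overfull[OF B] by blast
  have "f y < f x" if xy: "x \<in> B" "y \<in> E - B" "insert y (B - {x}) \<in> \<B>" for x y
  proof (rule ccontr)
    assume "\<not> f y < f x"
    moreover obtain X where X: "card (B \<inter> X) = matroid_rank \<B> X" "y \<in> X" "\<forall>x\<in>B \<inter> X. f y < f x"
      using R xy(2) unfolding blocking_def by blast
    ultimately have "x \<notin> X"
      using xy(1) by blast
    then have "insert y (B - {x}) \<inter> X = insert y (B \<inter> X)"
      using X(2) by blast
    then have "Suc (card (B \<inter> X)) \<le> matroid_rank \<B> X"
      using card_inter_le_rank[OF M xy(3), of X] xy(2) finite_basis[OF M BB] by simp
    with X(1) show False by simp
  qed
  with BB show "unique_max \<B> f B"
    by (auto simp: unique_max_iff_local[OF M])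
qed

lemma rank_pos:
  assumes "loopless E \<B>" "X \<subseteq> E" "X \<noteq> {}"
  shows "1 \<le> matroid_rank \<B> X"
proof -
  obtain x where "x \<in> X"
    using assms by blast
  then obtain B where x: "x \<in> X" "B \<in> \<B>" "x \<in> B"
    using assms unfolding loopless_def loop_def by blast
  then have "card (B \<inter> X) \<noteq> 0"
    using finite_basis[OF M] by auto
  with card_inter_le_rank[OF M x(2), of X] show ?thesis by simp
qed

context
  fixes C :: "'a set set"
  assumes C: "C \<in> ground_chains E"
begin

lemma chain_matroid_constraints:
  "(\<lambda>X. (X, matroid_rank \<B> X)) ` C \<subseteq> Pow E \<times> UNIV"
  "chain\<^sub>\<subseteq> (fst ` (\<lambda>X. (X, matroid_rank \<B> X)) ` C)"
  using C by (auto simp: ground_chains_def image_image)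

lemma matroid_chain_matroid: "matroid E (chain_matroid E \<B> C)"
  unfolding chain_matroid_def
  by (intro matroid_constraint_bases finite_ground[OF M] chain_matroid_constraints)

lemma nested_chain_matroid: "nested E (chain_matroid E \<B> C)"
  unfolding chain_matroid_def
  by (intro nested_constraint_bases finite_ground[OF M] chain_matroid_constraints)

lemma loopless_chain_matroid:
  assumes "loopless E \<B>"
  shows "loopless E (chain_matroid E \<B> C)"
  unfolding chain_matroid_def
proof (rule loopless_constraint_bases[OF finite_ground[OF M] chain_matroid_constraints])
  show "1 \<le> c" if "(X, c) \<in> (\<lambda>X. (X, matroid_rank \<B> X)) ` C" "X \<noteq> {}" for X c
    using that rank_pos[OF assms] C by (auto simp: ground_chains_def)
qed

text \<open>The constraint on \<open>E\<close> caps the size at the rank of \<open>\<B>\<close>, and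
  any basis of \<open>\<B>\<close> attains it.\<close>

lemma chain_matroid_iff:
  "B \<in> chain_matroid E \<B> C \<longleftrightarrow> B \<subseteq> E \<and> card B = matroid_rank \<B> E \<and> C \<inter> overfull E \<B> B = {}"
proof -
  let ?I = "constraint_indep E ((\<lambda>X. (X, matroid_rank \<B> X)) ` C)"
  have I_iff: "I \<in> ?I \<longleftrightarrow> I \<subseteq> E \<and> C \<inter> overfull E \<B> I = {}" for I
  proof -
    have "I \<in> ?I \<longleftrightarrow> I \<subseteq> E \<and> (\<forall>X\<in>C. \<not> matroid_rank \<B> X < card (I \<inter> X))"
      by (simp add: constraint_indep_def not_less)
    also have "\<dots> \<longleftrightarrow> I \<subseteq> E \<and> C \<inter> overfull E \<B> I = {}"
      using C unfolding overfull_def ground_chains_def by blast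
    finally show ?thesis .
  qed
  have le: "card I \<le> matroid_rank \<B> E" if "I \<in> ?I" for I
    using that C by (auto simp: constraint_indep_def ground_chains_def Int_absorb2)
  obtain A where A: "A \<in> \<B>"
    using bases_nonempty[OF M] by blast
  have cardA: "card A = matroid_rank \<B> E"
    using rank_ground[OF M A] by simp
  have "overfull E \<B> A = {}"
    using basis_iff_no_overfull[OF basis_subset[OF M A] cardA] A by simp
  then have AI: "A \<in> ?I"
    using basis_subset[OF M A] by (simp add: I_iff)
  have "card B = matroid_rank \<B> E" if "B \<in> chain_matroid E \<B> C"
    using that AI le[of B] cardA by (fastforce simp: chain_matroid_def constraint_bases_def)
  then have "B \<in> chain_matroid E \<B> C \<longleftrightarrow> B \<in> ?I \<and> card B = matroid_rank \<B> E"
    using le by (auto simp: chain_matroid_def constraint_bases_def)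
  then show ?thesis
    by (auto simp: I_iff)
qed

text \<open>The smallest tight member of \<open>C\<close> containing \<open>y\<close> blocks
  \<open>y\<close>. Replacing one of its elements \<open>x\<close> in \<open>B\<close> by
  \<open>y\<close> fills only members with \<open>y\<close> but not \<open>x\<close>; these are not
  tight, so the exchange is allowed and \<open>x\<close> must be heavier.\<close>

lemma unique_max_chain_matroid_iff:
  assumes B: "B \<subseteq> E" "card B = matroid_rank \<B> E"
  shows "unique_max (chain_matroid E \<B> C) f B \<longleftrightarrow>
    C \<inter> overfull E \<B> B = {} \<and> (\<forall>y\<in>E - B. C \<inter> blocking E \<B> f B y \<noteq> {})" (is "_ \<longleftrightarrow> ?R")
proof
  have finB: "finite B"
    using B(1) finite_ground[OF M] finite_subset by auto
  have card_ex: "card (insert y (B - {x})) = card B" if "x \<in> B" "y \<in> E - B" for x y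
    using that finB by (metis Diff_iff card_insert_disjoint card_Suc_Diff1 finite_Diff)
  {
    assume um: "unique_max (chain_matroid E \<B> C) f B"
    then have BC: "C \<inter> overfull E \<B> B = {}"
      and loc: "\<And>x y. \<lbrakk>x \<in> B; y \<in> E - B; insert y (B - {x}) \<in> chain_matroid E \<B> C\<rbrakk> \<Longrightarrow> f y < f x"
      by (auto simp: unique_max_iff_local[OF matroid_chain_matroid] chain_matroid_iff)
    have "C \<inter> blocking E \<B> f B y \<noteq> {}" if y: "y \<in> E - B" for y
    proof -
      define T where "T = {X \<in> C. y \<in> X \<and> card (B \<inter> X) = matroid_rank \<B> X}"
      have "E \<in> T"
        using C y B by (auto simp: T_def ground_chains_def Int_absorb2)
      moreover have "finite T"
        using C finite_ground[OF M] by (auto simp: T_def ground_chains_def intro: finite_subset[of _ "Pow E"])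
      moreover have "subset.chain T T"
        using C by (auto simp: T_def ground_chains_def subset_chain_def chain_subset_def)
      ultimately have XT: "\<Inter>T \<in> T"
        using Inter_in_chain by blast
      define X where "X = \<Inter>T"
      have X: "X \<in> C" "y \<in> X" "card (B \<inter> X) = matroid_rank \<B> X"
        and least: "\<And>Z. Z \<in> T \<Longrightarrow> X \<subseteq> Z"
        using XT by (auto simp: T_def X_def)
      have "f y < f x" if x: "x \<in> B \<inter> X" for x
      proof (rule loc)
        show "insert y (B - {x}) \<in> chain_matroid E \<B> C"
          unfolding chain_matroid_iff
        proof (intro conjI)
          show "insert y (B - {x}) \<subseteq> E" "card (insert y (B - {x})) = matroid_rank \<B> E"
            using B x y card_ex by auto
          have "card (insert y (B - {x}) \<inter> Z) \<le> matroid_rank \<B> Z" if Z: "Z \<in> C" for Z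
          proof -
            have ZE: "Z \<subseteq> E"
              using C Z by (auto simp: ground_chains_def)
            then have le: "card (B \<inter> Z) \<le> matroid_rank \<B> Z"
              using BC Z by (auto simp: overfull_def not_less)
            consider "y \<notin> Z" | "y \<in> Z" "x \<in> Z" | "y \<in> Z" "x \<notin> Z" by blast
            then show ?thesis
            proof cases
              case 1
              then have "insert y (B - {x}) \<inter> Z \<subseteq> B \<inter> Z" by blast
              then show ?thesis
                using le finB by (meson card_mono finite_Int order_trans)
            next
              case 2
              then have "insert y (B - {x}) \<inter> Z = insert y (B \<inter> Z - {x})"
                by blast
              moreover have "card \<dots> = card (B \<inter> Z)"
                using 2 x y finB
                by (metis Diff_iff IntD1 IntI card_insert_disjoint card_Suc_Diff1 finite_Diff finite_Int)
              ultimately show ?thesis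
                using le by simp
            next
              case 3
              then have "Z \<notin> T"
                using least x by blast
              then have "card (B \<inter> Z) < matroid_rank \<B> Z"
                using le Z 3 by (auto simp: T_def)
              moreover have "insert y (B - {x}) \<inter> Z = insert y (B \<inter> Z)"
                using 3 by blast
              ultimately show ?thesis
                using y finB by simp
            qed
          qed
          then show "C \<inter> overfull E \<B> (insert y (B - {x})) = {}"
            by (auto simp: overfull_def not_less[symmetric])
        qed
      qed (use x y in auto)
      with X C have "X \<in> C \<inter> blocking E \<B> f B y"
        by (auto simp: blocking_def ground_chains_def)
      then show ?thesis by blast
    qed
    with BC show ?R by blast
  }
  {
    assume R: ?R
    then have BC: "B \<in> chain_matroid E \<B> C"
      using B by (simp add: chain_matroid_iff)
    have "f y < f x" if xy: "x \<in> B" "y \<in> E - B" "insert y (B - {x}) \<in> chain_matroid E \<B> C" for x y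
    proof (rule ccontr)
      assume "\<not> f y < f x"
      moreover obtain X where X: "X \<in> C" "X \<subseteq> E" "card (B \<inter> X) = matroid_rank \<B> X" "y \<in> X"
        "\<forall>x\<in>B \<inter> X. f y < f x"
        using R xy(2) by (fastforce simp: blocking_def)
      ultimately have "x \<notin> X"
        using xy(1) by blast
      then have "insert y (B - {x}) \<inter> X = insert y (B \<inter> X)"
        using X(4) by blast
      moreover have "card (insert y (B - {x}) \<inter> X) \<le> matroid_rank \<B> X"
        using xy(3) X(1,2) by (auto simp: chain_matroid_iff overfull_def not_less)
      ultimately show False
        using X(3) xy(2) finB by simp
    qed
    with BC show "unique_max (chain_matroid E \<B> C) f B"
      by (auto simp: unique_max_iff_local[OF matroid_chain_matroid])
  }
qed

end

text \<open>If some set is overfull, take for \<open>F\<^sub>0\<close> the largest set of maximal excess \<open>|B \<inter> X| - rk X\<close>: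
  as the excess is supermodular, \<open>G \<inter> F\<^sub>0\<close> has at least the excess of \<open>G\<close>, and more unless
  \<open>G \<subseteq> F\<^sub>0\<close>. Otherwise the tight sets are closed under union, and so are the blocking ones.\<close>

lemma overfull_blocking_conical:
  assumes B: "B \<subseteq> E"
    and Q: "Q = overfull E \<B> B \<union> \<Union> (blocking E \<B> f B ` Y)" and ne: "Q \<noteq> {}"
  obtains F\<^sub>0 where "F\<^sub>0 \<in> Q" "\<And>G. G \<in> Q \<Longrightarrow> G \<inter> F\<^sub>0 \<in> Q"
proof -
  have fins: "finite B" "finite (Pow E)"
    using B finite_ground[OF M] finite_subset by auto
  define e where "e X = int (card (B \<inter> X)) - int (matroid_rank \<B> X)" for X
  have super: "e X + e X' \<le> e (X \<inter> X') + e (X \<union> X')" for X X'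
  proof -
    have "card (B \<inter> X) + card (B \<inter> X') = card (B \<inter> (X \<inter> X')) + card (B \<inter> (X \<union> X'))"
      using card_Un_Int[of "B \<inter> X" "B \<inter> X'"] fins by (simp add: Int_Un_distrib Int_ac)
    then show ?thesis
      using rank_submodular[OF M, of X X'] by (simp add: e_def)
  qed
  have over: "X \<in> overfull E \<B> B \<longleftrightarrow> X \<subseteq> E \<and> 0 < e X" for X
    by (auto simp: overfull_def e_def)
  have block: "X \<in> blocking E \<B> f B y \<longleftrightarrow> X \<subseteq> E \<and> e X = 0 \<and> y \<in> X \<and> (\<forall>x\<in>B \<inter> X. f y < f x)" for X y
    by (auto simp: blocking_def e_def)
  have QE: "X \<subseteq> E" "0 \<le> e X" if "X \<in> Q" for X
    using that by (auto simp: Q over block)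
  show thesis
  proof (cases "overfull E \<B> B = {}")
    case False
    define m where "m = Max (e ` Pow E)"
    have em: "e X \<le> m" if "X \<subseteq> E" for X
      using fins that unfolding m_def by (intro Max_ge) auto
    define S where "S = {X. X \<subseteq> E \<and> e X = m}"
    have "m \<in> e ` Pow E"
      unfolding m_def using fins by (intro Max_in) auto
    then have "S \<noteq> {}"
      by (auto simp: S_def)
    moreover have finS: "finite S"
      unfolding S_def by (rule finite_subset[OF _ fins(2)]) auto
    ultimately obtain F where F: "F \<in> S" and maximal: "\<And>X. X \<in> S \<Longrightarrow> F \<subseteq> X \<Longrightarrow> X = F"
      using finite_has_maximal[of S] by metis
    have FE: "F \<subseteq> E" "e F = m"
      using F by (auto simp: S_def)
    have "0 < m"
      using False em over by (metis all_not_in_conv less_le_trans)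
    have "F \<in> Q"
      using FE \<open>0 < m\<close> by (simp add: Q over)
    moreover have "G \<inter> F \<in> Q" if G: "G \<in> Q" for G
    proof (cases "G \<subseteq> F")
      case True
      then show ?thesis
        using G by (simp add: Int_absorb2)
    next
      case False
      have GE: "G \<union> F \<subseteq> E"
        using QE(1)[OF G] FE by blast
      then have "e (G \<union> F) \<noteq> m"
        using maximal[of "G \<union> F"] False by (auto simp: S_def)
      then have "e (G \<union> F) < m"
        using em[OF GE] by simp
      then have "0 < e (G \<inter> F)"
        using super[of G F] FE QE(2)[OF G] by simp
      then show ?thesis
        using FE by (auto simp: Q over)
    qed
    ultimately show thesis
      using that by blast
  next
    case True
    have e_le: "e X \<le> 0" if "X \<subseteq> E" for X
      using True that over by (metis all_not_in_conv not_less)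
    have union: "G \<union> H \<in> Q" if G: "G \<in> Q" and H: "H \<in> Q" for G H
    proof -
      obtain y z where y: "y \<in> Y" "G \<in> blocking E \<B> f B y" and z: "z \<in> Y" "H \<in> blocking E \<B> f B z"
        using G H True Q by auto
      have "G \<inter> H \<subseteq> E" "G \<union> H \<subseteq> E"
        using y z by (auto simp: block)
      then have "e (G \<union> H) = 0"
        using super[of G H] e_le[of "G \<inter> H"] e_le[of "G \<union> H"] y(2) z(2) by (auto simp: block)
      \<comment> \<open>The union blocks whichever of \<open>y\<close> and \<open>z\<close> is
        lighter.\<close>
      then have "G \<union> H \<in> blocking E \<B> f B y" if "f y \<le> f z"
        using y z \<open>e (G \<union> H) = 0\<close> by (auto simp: block intro: le_less_trans[OF that])
      moreover have "G \<union> H \<in> blocking E \<B> f B z" if "f z \<le> f y"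
        using y z \<open>e (G \<union> H) = 0\<close> by (auto simp: block intro: le_less_trans[OF that])
      ultimately show ?thesis
        using y(1) z(1) linear[of "f y" "f z"] by (auto simp: Q)
    qed
    have finQ: "finite Q"
      using QE by (intro finite_subset[OF _ fins(2)]) auto
    then obtain F where F: "F \<in> Q" "\<And>X. X \<in> Q \<Longrightarrow> F \<subseteq> X \<Longrightarrow> X = F"
      using finite_has_maximal[OF finQ ne] by metis
    \<comment> \<open>Closure under union makes the maximal \<open>F\<close> the greatest element of
      \<open>Q\<close>, so intersecting with it changes nothing.\<close>
    have "G \<inter> F = G" if "G \<in> Q" for G
      using F(2)[OF union[OF that F(1)]] by blast
    then show thesis
      using that[of F] F(1) by metis
  qed
qed

text \<open>For each candidate \<open>B\<close>, inclusion-exclusion reduces the criterion for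
  \<open>C\<close> to avoiding the families \<open>Q Y\<close>. The weighted sum over
  \<open>C\<close> leaves only the indicator of \<open>Q Y = {}\<close>, and inclusion-exclusion
  read backwards gives the criterion for \<open>\<B>\<close>.\<close>

lemma generic_chain_expansion:
  fixes w :: "'a set set \<Rightarrow> real"
  assumes w: "\<And>D. D \<in> ground_chains E \<Longrightarrow> (\<Sum>C | C \<in> ground_chains E \<and> D \<subseteq> C. w C) = 1"
  shows "of_bool (generic \<B> f) = (\<Sum>C\<in>ground_chains E. w C * of_bool (generic (chain_matroid E \<B> C) f))"
proof -
  let ?\<C> = "ground_chains E"
  let ?R = "{B. B \<subseteq> E \<and> card B = matroid_rank \<B> E}"
  have fin: "finite E"
    by (rule finite_ground[OF M])
  have expand: "of_bool (unique_max \<B> f B) =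
      (\<Sum>C\<in>?\<C>. w C * of_bool (unique_max (chain_matroid E \<B> C) f B))" if "B \<in> ?R" for B
  proof -
    have B: "B \<subseteq> E" "card B = matroid_rank \<B> E"
      using that by auto
    let ?T = "blocking E \<B> f B" and ?O = "overfull E \<B> B"
    define Q where "Q Y = ?O \<union> \<Union> (?T ` Y)" for Y
    have QE: "Q Y \<subseteq> Pow E" for Y
      by (auto simp: Q_def overfull_def blocking_def)
    have avoid: "(\<Sum>C\<in>?\<C>. w C * of_bool (C \<inter> Q Y = {})) = of_bool (Q Y = {})" for Y
    proof (cases "Q Y = {}")
      case True
      then show ?thesis
        using sum_weights_avoiding[OF fin QE w, of Y] by (simp add: chain_subset_def conj_commute cong: conj_cong)
    next
      case False
      obtain F where "F \<in> Q Y" "\<And>G. G \<in> Q Y \<Longrightarrow> G \<inter> F \<in> Q Y"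
        using overfull_blocking_conical[OF B(1) Q_def False] by metis
      moreover have "finite (Q Y)"
        using QE[of Y] fin by (simp add: finite_subset)
      ultimately show ?thesis
        using sum_weights_avoiding[OF fin QE w, of Y] signed_chain_count_eq_0[of "Q Y"] False by simp
    qed
    have finB: "finite (E - B)"
      using fin by simp
    have "(\<Sum>C\<in>?\<C>. w C * of_bool (unique_max (chain_matroid E \<B> C) f B)) =
        (\<Sum>C\<in>?\<C>. \<Sum>Y\<in>Pow (E - B). (- 1) ^ card Y * (w C * of_bool (C \<inter> Q Y = {})))"
    proof (intro sum.cong refl)
      fix C assume "C \<in> ?\<C>"
      from unique_max_chain_matroid_iff[OF this B, of f]
      have "(of_bool (unique_max (chain_matroid E \<B> C) f B) :: real) =
          (\<Sum>Y\<in>Pow (E - B). (- 1) ^ card Y * of_bool (C \<inter> Q Y = {}))"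
        using of_bool_hits_inclusion_exclusion[OF finB, of C ?O ?T] by (simp only: Q_def)
      then show "w C * of_bool (unique_max (chain_matroid E \<B> C) f B) =
          (\<Sum>Y\<in>Pow (E - B). (- 1) ^ card Y * (w C * of_bool (C \<inter> Q Y = {})))"
        by (simp only: sum_distrib_left mult_ac)
    qed
    also have "\<dots> = (\<Sum>Y\<in>Pow (E - B). (- 1) ^ card Y * (\<Sum>C\<in>?\<C>. w C * of_bool (C \<inter> Q Y = {})))"
      by (subst sum.swap) (simp only: sum_distrib_left)
    \<comment> \<open>With \<open>UNIV\<close> in the place of the chain, the sum has the shape of
      \<open>of_bool_hits_inclusion_exclusion\<close> again.\<close>
    also have "\<dots> = (\<Sum>Y\<in>Pow (E - B). (- 1) ^ card Y * of_bool (UNIV \<inter> Q Y = {}))"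
      by (simp only: avoid Int_UNIV_left)
    also have "\<dots> = of_bool (unique_max \<B> f B)"
      using of_bool_hits_inclusion_exclusion[OF finB, of UNIV ?O ?T] unique_max_iff_blocking[OF B, of f]
      by (simp only: Q_def Int_UNIV_left)
    finally show ?thesis by simp
  qed
  have "of_bool (generic \<B> f) = (\<Sum>B\<in>?R. of_bool (unique_max \<B> f B) :: real)"
    using rank_ground[OF M] by (intro of_bool_generic[OF M]) simp
  also have "\<dots> = (\<Sum>B\<in>?R. \<Sum>C\<in>?\<C>. w C * of_bool (unique_max (chain_matroid E \<B> C) f B))"
    by (intro sum.cong refl expand)
  also have "\<dots> = (\<Sum>C\<in>?\<C>. w C * (\<Sum>B\<in>?R. of_bool (unique_max (chain_matroid E \<B> C) f B)))"
    by (subst sum.swap) (simp only: sum_distrib_left)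
  also have "\<dots> = (\<Sum>C\<in>?\<C>. w C * of_bool (generic (chain_matroid E \<B> C) f))"
  proof (intro sum.cong refl arg_cong2[where f = "(*)"])
    fix C assume "C \<in> ?\<C>"
    then show "(\<Sum>B\<in>?R. of_bool (unique_max (chain_matroid E \<B> C) f B)) =
        (of_bool (generic (chain_matroid E \<B> C) f) :: real)"
      by (intro of_bool_generic[symmetric] matroid_chain_matroid) (simp_all add: chain_matroid_iff)
  qed
  finally show ?thesis .
qed

end

section \<open>Removing loops\<close>

text \<open>Joining the set \<open>L\<close> of loops to every basis shifts all weights by the
  constant \<open>sum f L\<close>, so every comparison persists.\<close>

lemma ex_loopless_same_generic:
  assumes M: "matroid E \<B>"
  obtains \<B>' where "matroid E \<B>'" "loopless E \<B>'" "\<And>f. generic \<B>' f \<longleftrightarrow> generic \<B> f"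
proof -
  define L where "L = {x. loop E \<B> x}"
  have LE: "L \<subseteq> E" and disj: "\<And>B. B \<in> \<B> \<Longrightarrow> B \<inter> L = {}"
    by (auto simp: L_def loop_def)
  have finL: "finite L"
    using LE finite_ground[OF M] finite_subset by auto
  let ?\<B> = "(\<lambda>B. B \<union> L) ` \<B>"
  have "matroid E ?\<B>"
    unfolding matroid_def
  proof (intro conjI ballI)
    show "finite E" "?\<B> \<noteq> {}"
      using finite_ground[OF M] bases_nonempty[OF M] by auto
    show "B \<subseteq> E" if "B \<in> ?\<B>" for B
      using that LE basis_subset[OF M] by auto
    fix A B x assume "A \<in> ?\<B>" "B \<in> ?\<B>" and x: "x \<in> A - B"
    then obtain A' B' where A: "A = A' \<union> L" "A' \<in> \<B>" and B: "B = B' \<union> L" "B' \<in> \<B>" by blast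
    have "x \<in> A'" "x \<notin> B'" "x \<notin> L"
      using x A B by auto
    then obtain y where y: "y \<in> B'" "y \<notin> A'" "insert y (A' - {x}) \<in> \<B>"
      using basis_exchange[OF M A(2) B(2)] by metis
    have "y \<in> B - A"
      using y A B disj by auto
    moreover have "insert y (A - {x}) = insert y (A' - {x}) \<union> L"
      using A \<open>x \<notin> L\<close> by blast
    ultimately show "\<exists>y\<in>B - A. insert y (A - {x}) \<in> ?\<B>"
      using y(3) by blast
  qed
  moreover have "loopless E ?\<B>"
  proof -
    have "\<not> loop E ?\<B> x" for x
    proof
      assume "loop E ?\<B> x"
      then have x: "x \<in> E" "\<And>B. B \<in> \<B> \<Longrightarrow> x \<notin> B \<union> L"
        by (auto simp: loop_def)
      then have "x \<in> L"
        by (simp add: L_def loop_def)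
      with x(2) bases_nonempty[OF M] show False by blast
    qed
    then show ?thesis
      by (simp add: loopless_def)
  qed
  moreover have "generic ?\<B> f \<longleftrightarrow> generic \<B> f" for f
  proof -
    have sum: "sum f (B \<union> L) = sum f B + sum f L" if "B \<in> \<B>" for B
      using disj[OF that] finite_basis[OF M that] finL by (simp add: sum.union_disjoint)
    have inj: "A \<union> L = B \<union> L \<longleftrightarrow> A = B" if "A \<in> \<B>" "B \<in> \<B>" for A B
      using disj that by blast
    have "unique_max ?\<B> f (B \<union> L) \<longleftrightarrow> unique_max \<B> f B" if "B \<in> \<B>" for B
    proof -
      have "(\<forall>A\<in>\<B>. A \<union> L \<noteq> B \<union> L \<longrightarrow> sum f (A \<union> L) < sum f (B \<union> L)) \<longleftrightarrow>
          (\<forall>A\<in>\<B>. A \<noteq> B \<longrightarrow> sum f A < sum f B)"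
        using that by (intro ball_cong) (simp_all add: sum inj)
      moreover have "B \<union> L \<in> ?\<B>"
        using that by (rule imageI)
      ultimately show ?thesis
        using that by (simp only: unique_max_def ball_simps simp_thms)
    qed
    then have "(\<exists>B\<in>?\<B>. unique_max ?\<B> f B) \<longleftrightarrow> (\<exists>B\<in>\<B>. unique_max \<B> f B)"
      by simp
    then have "(\<exists>B. unique_max ?\<B> f B) \<longleftrightarrow> (\<exists>B. unique_max \<B> f B)"
      by (metis unique_max_def)
    then show ?thesis
      by (simp add: generic_iff_unique_max[OF M] generic_iff_unique_max[OF \<open>matroid E ?\<B>\<close>])
  qed
  ultimately show thesis
    using that by blast
qed

section \<open>Set composition types\<close>

text \<open>Recovers the order of the values from the composition type; by
  \<open>unique_max_iff_local\<close>, that order decides genericity.\<close>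

lemma less_iff_set_composition_type:
  assumes "i \<in> {1..d}" "j \<in> {1..d}"
  shows "f i < f j \<longleftrightarrow> (\<exists>k l. k < l \<and> l < length (set_composition_type d f) \<and>
    i \<in> set_composition_type d f ! k \<and> j \<in> set_composition_type d f ! l)" (is "_ \<longleftrightarrow> ?R")
proof -
  define vs where "vs = sorted_list_of_set (f ` {1..d})"
  have vs: "sorted_wrt (<) vs" "set vs = f ` {1..d}"
    by (simp_all add: vs_def)
  have T: "set_composition_type d f = map (\<lambda>v. {i \<in> {1..d}. f i = v}) vs"
    by (simp add: set_composition_type_def vs_def)
  show ?thesis
  proof
    assume less: "f i < f j"
    have "f i \<in> set vs" "f j \<in> set vs"
      using assms vs(2) by auto
    then obtain k l where kl: "k < length vs" "l < length vs" "vs ! k = f i" "vs ! l = f j"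
      by (metis in_set_conv_nth)
    have "k < l"
    proof (rule ccontr)
      assume "\<not> k < l"
      then have "vs ! l \<le> vs ! k"
        using sorted_wrt_nth_less[OF vs(1), of l k] kl by (cases "k = l") auto
      with less kl show False by simp
    qed
    with kl assms show ?R
      by (intro exI[of _ k] exI[of _ l]) (auto simp: T)
  next
    assume ?R
    then obtain k l where "k < l" "l < length vs" "f i = vs ! k" "f j = vs ! l"
      by (auto simp: T)
    then show "f i < f j"
      using sorted_wrt_nth_less[OF vs(1)] by simp
  qed
qed

lemma generic_cong_set_composition_type:
  assumes M: "matroid {1..d} \<B>" and "set_composition_type d f = set_composition_type d g"
  shows "generic \<B> (\<lambda>i. real (f i)) \<longleftrightarrow> generic \<B> (\<lambda>i. real (g i))"
proof -
  have less: "f i < f j \<longleftrightarrow> g i < g j" if "i \<in> {1..d}" "j \<in> {1..d}" for i j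
    using less_iff_set_composition_type[OF that] assms(2) by simp
  have "unique_max \<B> (\<lambda>i. real (f i)) B \<longleftrightarrow> unique_max \<B> (\<lambda>i. real (g i)) B" for B
    unfolding unique_max_iff_local[OF M] of_nat_less_iff
  proof (intro conj_cong ball_cong imp_cong refl)
    fix x y assume "B \<in> \<B>" "x \<in> B" "y \<in> {1..d} - B"
    then show "f y < f x \<longleftrightarrow> g y < g x"
      using less basis_subset[OF M] by blast
  qed
  then show ?thesis
    by (simp add: generic_iff_unique_max[OF M])
qed

section \<open>The image of \<open>\<Psi>\<close>\<close>

lemma ncseries_eqI: "(\<And>u. coeff p u = coeff q u) \<Longrightarrow> p = q"
  by (metis coeff_inject ext)

lemma coeff_word_series:
  "coeff (word_series d c) u = (\<Sum>f | f \<in> positive_maps d \<and> word d f = u. c f)"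
  by (simp add: word_series_def Series_inverse)

lemma coeff_add [simp]: "coeff (p + q) u = coeff p u + coeff q u"
  and coeff_scaleR [simp]: "coeff (r *\<^sub>R p) u = r * coeff p u"
  and coeff_zero [simp]: "coeff 0 u = 0"
  by (transfer; simp)+

lemma coeff_sum: "coeff (sum p A) u = (\<Sum>i\<in>A. coeff (p i) u)"
  by (induction A rule: infinite_finite_induct) auto

lemma word_series_sum:
  "word_series d (\<lambda>f. \<Sum>i\<in>A. a i * c i f) = (\<Sum>i\<in>A. a i *\<^sub>R word_series d (c i))"
proof (rule ncseries_eqI)
  fix u
  show "coeff (word_series d (\<lambda>f. \<Sum>i\<in>A. a i * c i f)) u = coeff (\<Sum>i\<in>A. a i *\<^sub>R word_series d (c i)) u"
    unfolding coeff_sum coeff_scaleR coeff_word_series by (subst sum.swap) (simp add: sum_distrib_left)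
qed

lemma im_Psi_subset_WQSym: "im_Psi d \<subseteq> WQSym d"
proof
  fix p assume "p \<in> im_Psi d"
  then obtain x where x: "x \<in> Mat d" and p: "p = Psi_lin d x"
    by (auto simp: im_Psi_def)
  define c where "c f = (\<Sum>\<B>\<in>Poly_Mapping.keys x. Poly_Mapping.lookup x \<B> * of_bool (generic \<B> (\<lambda>i. real (f i))))"
    for f :: "nat \<Rightarrow> nat"
  have "p = word_series d c"
    unfolding p Psi_lin_def Psi_def c_def by (rule word_series_sum[symmetric])
  moreover have "c f = c g" if "set_composition_type d f = set_composition_type d g" for f g
    unfolding c_def using x generic_cong_set_composition_type[OF _ that]
    by (intro sum.cong refl) (auto simp: Mat_def)
  ultimately show "p \<in> WQSym d"
    unfolding WQSym_def by blast
qed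

lemma finite_matroids: "finite E \<Longrightarrow> finite {\<B>. matroid E \<B>}"
  by (rule finite_subset[of _ "Pow (Pow E)"]) (auto simp: matroid_def)

text \<open>There are finitely many matroids on \<open>{1..d}\<close>, so the image consists of the
  sums over all of them with arbitrary coefficients.\<close>

lemma im_Psi_eq_span: "im_Psi d = span (Psi d ` {\<B>. matroid {1..d} \<B>})" (is "_ = span (Psi d ` ?M)")
proof
  show "im_Psi d \<subseteq> span (Psi d ` ?M)"
  proof
    fix p assume "p \<in> im_Psi d"
    then obtain x where x: "\<forall>\<B>\<in>Poly_Mapping.keys x. matroid {1..d} \<B>" and p: "p = Psi_lin d x"
      by (auto simp: im_Psi_def Mat_def)
    show "p \<in> span (Psi d ` ?M)"
      unfolding p Psi_lin_def by (intro span_sum span_scale span_base imageI) (use x in blast)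
  qed
next
  have finM: "finite ?M"
    by (simp add: finite_matroids)
  have im: "(\<Sum>\<B>\<in>?M. u \<B> *\<^sub>R Psi d \<B>) \<in> im_Psi d" for u
  proof -
    \<comment> \<open>Extending \<open>u\<close> by 0 outside the matroids gives an element of
      \<open>Mat d\<close>.\<close>
    define x where "x = Poly_Mapping.Abs_poly_mapping (\<lambda>\<B>. if \<B> \<in> ?M then u \<B> else 0)"
    have lookup: "Poly_Mapping.lookup x = (\<lambda>\<B>. if \<B> \<in> ?M then u \<B> else 0)"
      unfolding x_def using finM by (intro lookup_Abs_poly_mapping) (auto intro: rev_finite_subset)
    then have keys: "Poly_Mapping.keys x \<subseteq> ?M"
      by (auto simp: in_keys_iff split: if_splits)
    have "Psi_lin d x = (\<Sum>\<B>\<in>?M. Poly_Mapping.lookup x \<B> *\<^sub>R Psi d \<B>)"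
      unfolding Psi_lin_def using keys finM by (intro sum.mono_neutral_left) (auto simp: in_keys_iff)
    also have "\<dots> = (\<Sum>\<B>\<in>?M. u \<B> *\<^sub>R Psi d \<B>)"
      by (intro sum.cong) (auto simp: lookup)
    finally show ?thesis
      using keys unfolding im_Psi_def Mat_def by (intro image_eqI[of _ _ x]) auto
  qed
  have im_ex: "\<exists>u. p = (\<Sum>\<B>\<in>?M. u \<B> *\<^sub>R Psi d \<B>)" if im_p: "p \<in> im_Psi d" for p
  proof -
    obtain x where "x \<in> Mat d" and p: "p = Psi_lin d x"
      using im_p by (auto simp: im_Psi_def)
    then have x: "Poly_Mapping.keys x \<subseteq> ?M"
      unfolding Mat_def by blast
    have "p = (\<Sum>\<B>\<in>?M. Poly_Mapping.lookup x \<B> *\<^sub>R Psi d \<B>)"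
      unfolding p Psi_lin_def using x finM by (intro sum.mono_neutral_left) (auto simp: in_keys_iff)
    then show ?thesis by blast
  qed
  have "subspace (im_Psi d)"
  proof (rule subspaceI)
    show "0 \<in> im_Psi d"
      using im[of "\<lambda>_. 0"] by simp
    show "p + q \<in> im_Psi d" if pq: "p \<in> im_Psi d" "q \<in> im_Psi d" for p q
    proof -
      obtain u v where "p = (\<Sum>\<B>\<in>?M. u \<B> *\<^sub>R Psi d \<B>)" "q = (\<Sum>\<B>\<in>?M. v \<B> *\<^sub>R Psi d \<B>)"
        using im_ex pq by blast
      then show ?thesis
        using im[of "\<lambda>\<B>. u \<B> + v \<B>"] by (simp add: scaleR_left_distrib sum.distrib)
    qed
    show "r *\<^sub>R p \<in> im_Psi d" if p: "p \<in> im_Psi d" for r p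
    proof -
      obtain u where "p = (\<Sum>\<B>\<in>?M. u \<B> *\<^sub>R Psi d \<B>)"
        using im_ex p by blast
      then show ?thesis
        using im[of "\<lambda>\<B>. r * u \<B>"] by (simp add: scaleR_sum_right)
    qed
  qed
  moreover have "Psi d \<B> \<in> im_Psi d" if "\<B> \<in> ?M" for \<B>
  proof -
    have "(\<Sum>\<A>\<in>?M. of_bool (\<A> = \<B>) *\<^sub>R Psi d \<A>) = Psi d \<B>"
      using finM that by (simp add: of_bool_def if_distrib[of "\<lambda>r. r *\<^sub>R _"] sum.delta cong: if_cong)
    then show ?thesis
      using im[of "\<lambda>\<A>. of_bool (\<A> = \<B>)"] by simp
  qed
  ultimately show "span (Psi d ` ?M) \<subseteq> im_Psi d"
    by (intro span_minimal) auto
qed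

text \<open>Serves both claims: chain matroids of a loopless matroid are loopless and nested, and
  they come from reduced systems.\<close>

lemma Psi_in_span_chain_matroids:
  assumes "matroid {1..d} \<B>"
  obtains \<B>' where "matroid {1..d} \<B>'" "loopless {1..d} \<B>'"
    "Psi d \<B> \<in> span ((\<lambda>C. Psi d (chain_matroid {1..d} \<B>' C)) ` ground_chains {1..d})"
proof -
  obtain \<B>' where M: "matroid {1..d} \<B>'" and ll: "loopless {1..d} \<B>'"
    and gen: "\<And>f. generic \<B>' f \<longleftrightarrow> generic \<B> f"
    by (rule ex_loopless_same_generic[OF assms]) blast
  obtain w :: "nat set set \<Rightarrow> real"
    where w: "\<And>D. D \<in> ground_chains {1..d} \<Longrightarrow> (\<Sum>C | C \<in> ground_chains {1..d} \<and> D \<subseteq> C. w C) = 1"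
    using ex_superset_weights[OF finite_ground_chains[of "{1..d}"]] by auto
  have "Psi d \<B> = Psi d \<B>'"
    by (simp add: Psi_def gen)
  also have "\<dots> = (\<Sum>C\<in>ground_chains {1..d}. w C *\<^sub>R Psi d (chain_matroid {1..d} \<B>' C))"
  proof -
    have "(\<lambda>f. of_bool (generic \<B>' (\<lambda>i. real (f i)))) =
        (\<lambda>f. \<Sum>C\<in>ground_chains {1..d}. w C * of_bool (generic (chain_matroid {1..d} \<B>' C) (\<lambda>i. real (f i))))"
      by (intro ext generic_chain_expansion[OF M] w)
    then show ?thesis
      by (simp only: Psi_def word_series_sum)
  qed
  also have "\<dots> \<in> span ((\<lambda>C. Psi d (chain_matroid {1..d} \<B>' C)) ` ground_chains {1..d})"
    by (intro span_sum span_scale span_base imageI)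
  finally show thesis
    using that M ll by blast
qed

text \<open>The bases depend on a system only through its independent sets, which dropping redundant
  constraints preserves.\<close>

lemma chain_matroid_eq_reduced:
  assumes M: "matroid E \<B>" and ll: "loopless E \<B>" and C: "C \<in> ground_chains E"
  shows "chain_matroid E \<B> C \<in> constraint_bases E ` {K. K \<subseteq> Pow E \<times> UNIV \<and> reduced K}"
proof -
  let ?K = "(\<lambda>X. (X, matroid_rank \<B> X)) ` C"
  have fin: "finite E"
    by (rule finite_ground[OF M])
  then have "finite ?K"
    using C by (auto simp: ground_chains_def intro!: finite_imageI intro: finite_subset[of _ "Pow E"])
  moreover have "1 \<le> c" if "(X, c) \<in> ?K" "X \<noteq> {}" for X c
    using that rank_pos[OF M ll] C by (auto simp: ground_chains_def)
  ultimately obtain L where "L \<subseteq> Pow E \<times> UNIV" "reduced L" "constraint_indep E L = constraint_indep E ?K"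
    using ex_reduced[OF fin _ chain_matroid_constraints[OF M C]] by metis
  then show ?thesis
    by (intro image_eqI[of _ _ L]) (auto simp: chain_matroid_def constraint_bases_def)
qed

text \<open>A finite spanning set is asserted as well because \<open>dim\<close> is 0 on
  infinite-dimensional spaces, where the bound would say nothing.\<close>

theorem corollary4p8:
  fixes d :: nat
  shows "im_Psi d \<subseteq> WQSym d
    \<and> im_Psi d = span {Psi d \<B> | \<B>. matroid {1..d} \<B> \<and> loopless {1..d} \<B> \<and> nested {1..d} \<B>}
    \<and> (\<exists>S. finite S \<and> im_Psi d = span S)
    \<and> dim (im_Psi d) \<le> fact d"
proof (intro conjI)
  let ?E = "{1..d}"
  let ?N = "{Psi d \<B> | \<B>. matroid ?E \<B> \<and> loopless ?E \<B> \<and> nested ?E \<B>}"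
  let ?M = "{\<B>. matroid ?E \<B>}"
  let ?R = "{K. K \<subseteq> Pow ?E \<times> UNIV \<and> reduced K}"
  show "im_Psi d \<subseteq> WQSym d"
    by (rule im_Psi_subset_WQSym)
  show "im_Psi d = span ?N"
  proof
    have "Psi d \<B> \<in> span ?N" if B: "matroid ?E \<B>" for \<B>
    proof -
      obtain \<B>' where M: "matroid ?E \<B>'" and ll: "loopless ?E \<B>'"
        and Psi: "Psi d \<B> \<in> span ((\<lambda>C. Psi d (chain_matroid ?E \<B>' C)) ` ground_chains ?E)"
        by (rule Psi_in_span_chain_matroids[OF B])
      have "(\<lambda>C. Psi d (chain_matroid ?E \<B>' C)) ` ground_chains ?E \<subseteq> ?N"
        using matroid_chain_matroid[OF M] loopless_chain_matroid[OF M _ ll] nested_chain_matroid[OF M]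
        by blast
      from span_mono[OF this] Psi show ?thesis
        by (rule subsetD)
    qed
    then show "im_Psi d \<subseteq> span ?N"
      unfolding im_Psi_eq_span by (intro span_minimal subspace_span) auto
    show "span ?N \<subseteq> im_Psi d"
      unfolding im_Psi_eq_span by (rule span_mono) auto
  qed
  show "\<exists>S. finite S \<and> im_Psi d = span S"
    using im_Psi_eq_span finite_matroids[of ?E] by (metis finite_atLeastAtMost finite_imageI)
  \<comment> \<open>For the bound, the chain matroids are indexed by reduced systems, of which there
    are at most \<open>fact d\<close>.\<close>
  have "Psi d \<B> \<in> span (Psi d ` constraint_bases ?E ` ?R)" if B: "matroid ?E \<B>" for \<B>
  proof -
    obtain \<B>' where M: "matroid ?E \<B>'" and ll: "loopless ?E \<B>'"
      and Psi: "Psi d \<B> \<in> span ((\<lambda>C. Psi d (chain_matroid ?E \<B>' C)) ` ground_chains ?E)"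
      by (rule Psi_in_span_chain_matroids[OF B])
    have "(\<lambda>C. Psi d (chain_matroid ?E \<B>' C)) ` ground_chains ?E \<subseteq> Psi d ` constraint_bases ?E ` ?R"
      by (intro image_subsetI imageI[where f = "Psi d"] chain_matroid_eq_reduced[OF M ll])
    from span_mono[OF this] Psi show ?thesis
      by (rule subsetD)
  qed
  then have "im_Psi d \<subseteq> span (Psi d ` constraint_bases ?E ` ?R)"
    unfolding im_Psi_eq_span by (intro span_minimal subspace_span) auto
  then have "dim (im_Psi d) \<le> card (Psi d ` constraint_bases ?E ` ?R)"
    using card_reduced_le(1)[of ?E] by (intro dim_le_card) auto
  also have "\<dots> \<le> card ?R"
    using card_reduced_le(1)[of ?E] by (simp add: image_image card_image_le)
  also have "\<dots> \<le> fact d"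
    using card_reduced_le(2)[of ?E] by simp
  finally show "dim (im_Psi d) \<le> fact d" .
qed

end
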